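(* Let $A$ be an associative unital algebra over a commutative field $\mathbb{K}$, with product $\mu$ and unit $1_A$, and let $\sigma\in\mathrm{Aut}(A\otimes A)$ be a linear automorphism satisfying (1) $\sigma_2\sigma_1\sigma_2=\sigma_1\sigma_2\sigma_1$ on $A^{\otimes 3}$; (2) $\sigma_1(\mu\otimes\mathrm{Id})=(\mathrm{Id}\otimes\mu)\sigma_1\sigma_2$ and $\sigma_1(\mathrm{Id}\otimes\mu)=(\mu\otimes\mathrm{Id})\sigma_2\sigma_1$ on $A^{\otimes 3}$; (3) $\sigma(a\otimes 1_A)=1_A\otimes a$ and $\sigma(1_A\otimes a)=a\otimes 1_A$ for all $a\in A$. Then the (signed) quantum shuffle product $\varphi_\sigma:T(A)\otimes T(A)\to T(A)$ factorizes as $$\varphi_\sigma=\mu^{\otimes}\circ\Theta ,$$ that is, for every $n\ge 0$ the restriction of $\varphi_\sigma$ to $\bigoplus_{p+q=n}A^{\otimes p}\otimes A^{\otimes q}$ equals $\mu^{\otimes n}\circ\Theta_n$, where $\mu^{\otimes n}:(A\otimes A)^{\otimes n}\to A^{\otimes n}$ is the product $\mu$ tensorized $n$ times.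
   Context: $T(A)=\bigoplus_{k\ge 0}A^{\otimes k}$ is the tensor vector space. For $i<n$, $\sigma_i=\mathrm{Id}^{\otimes i-1}\otimes\sigma\otimes\mathrm{Id}^{\otimes n-i-1}$ on $A^{\otimes n}$. Juxtaposition of maps is composition (rightmost applied first). Shuffles: for $p+q=n$, $S_{p,n}$ is the set of $(p,q)$-shuffles, i.e. permutations $w$ of $\{1,\dots,n\}$ with $w(1)<\dots<w(p)$ and $w(p+1)<\dots<w(n)$; $(-1)^{|w|}$ is the sign of $w$. If $w=\nu_{i_1}\cdots\nu_{i_r}$ is a reduced decomposition into the transpositions $\nu_i=(i,i+1)$, then $T_\sigma(w)=\sigma_{i_1}\cdots\sigma_{i_r}$. Quantum shuffle product (with sign): for positive $p+q=n$, $\varphi_\sigma(\underline v\otimes\underline v')=\sum_{w\in S_{p,n}}(-1)^{|w|}T_\sigma(w)(\underline v\otimes\underline v')$ for $\underline v\in A^{\otimes p},\underline v'\in A^{\otimes q}$; if $p=0$ or $q=0$ it is multiplication by scalars of $\mathbb{K}$. The map $\Theta$: for $0\le i\le p$ let $s'_i:A^{\otimes p}\to A^{\otimes p+1}$, $s'_i(a^1\otimes\cdots\otimes a^p)=a^1\otimes\cdots\otimes a^i\otimes 1_A\otimes a^{i+1}\otimes\cdots\otimes a^p$. Let $g':A^{\otimes p}\otimes A^{\otimes n-p}\to A^{\otimes n}\otimes A^{\otimes n}$ be $$g'=\sum_{\nu\in S_{p,n}}(-1)^{|\nu|}\,s'_{\nu(n)-1}\cdots s'_{\nu(p+1)-1}\otimes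 s'_{\nu(p)-1}\cdots s'_{\nu(1)-1}.$$ For $m\ge 0$ let $\psi_m:A^{\otimes m+2}\otimes A^{\otimes m+2}\to (A\otimes A)^{\otimes m+2}$ be $$\psi_m=\sigma_{2m+2}\circ(\sigma_{2m}\sigma_{2m+1})\circ\cdots\circ(\sigma_4\cdots\sigma_{m+3})\circ(\sigma_2\cdots\sigma_{m+2}).$$ Then $\Theta_n=\psi_{n-2}\circ g':\bigoplus_{p+q=n}A^{\otimes p}\otimes A^{\otimes q}\to(A\otimes A)^{\otimes n}$, with $\psi_{-1}=\mathrm{Id}_{A\otimes A}$ and $\psi_{-2}=\mathrm{Id}_{\mathbb{K}}$. *)

theory Defs
  imports Complex_Main "HOL-Library.Poly_Mapping" "HOL-Combinatorics.Permutations"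
begin

locale unital_algebra = vector_space scale + monoid mul one
  for scale :: "'k::field \<Rightarrow> 'a::ab_group_add \<Rightarrow> 'a"
    and mul :: "'a \<Rightarrow> 'a \<Rightarrow> 'a" and one :: 'a +
  assumes mul_linear_right: "Vector_Spaces.linear scale scale (\<lambda>y. mul x y)"
    and mul_linear_left: "Vector_Spaces.linear scale scale (\<lambda>x. mul x y)"

section \<open>Quotients of free vector spaces\<close>

text \<open>
  The free vector space on a type \<open>'x\<close> is \<open>'x \<Rightarrow>\<^sub>0 'k\<close>. Its quotient by a subspace \<open>N\<close> consists of
  the sets \<open>coset N x\<close>. The field acts on \<open>'a\<close> through a term \<open>scale\<close>, so tensor spaces over
  \<open>scale\<close> cannot be types of their own; they are sets of cosets.
\<close>

definition pm_scale :: "'k::field \<Rightarrow> ('x \<Rightarrow>\<^sub>0 'k) \<Rightarrow> ('x \<Rightarrow>\<^sub>0 'k)" where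
  "pm_scale c f = Poly_Mapping.map ((*) c) f"

definition coset :: "('x \<Rightarrow>\<^sub>0 'k::field) set \<Rightarrow> ('x \<Rightarrow>\<^sub>0 'k) \<Rightarrow> ('x \<Rightarrow>\<^sub>0 'k) set" where
  "coset N x = (+) x ` N"

definition rep :: "'b set \<Rightarrow> 'b" where
  "rep X = (SOME x. x \<in> X)"

definition qadd :: "('x \<Rightarrow>\<^sub>0 'k::field) set \<Rightarrow> ('x \<Rightarrow>\<^sub>0 'k) set \<Rightarrow> ('x \<Rightarrow>\<^sub>0 'k) set \<Rightarrow> ('x \<Rightarrow>\<^sub>0 'k) set" where
  "qadd N X Y = coset N (rep X + rep Y)"

definition qscale :: "('x \<Rightarrow>\<^sub>0 'k::field) set \<Rightarrow> 'k \<Rightarrow> ('x \<Rightarrow>\<^sub>0 'k) set \<Rightarrow> ('x \<Rightarrow>\<^sub>0 'k) set" where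
  "qscale N c X = coset N (pm_scale c (rep X))"

definition qsum :: "('x \<Rightarrow>\<^sub>0 'k::field) set \<Rightarrow> ('i \<Rightarrow> ('x \<Rightarrow>\<^sub>0 'k) set) \<Rightarrow> 'i set \<Rightarrow> ('x \<Rightarrow>\<^sub>0 'k) set" where
  "qsum N X I = coset N (\<Sum>i\<in>I. rep (X i))"

text \<open>
  \<open>lift N D F\<close> is the linear map, from a quotient of the free vector space on \<open>'y\<close> to the quotient
  by \<open>N\<close>, that sends the class of a generator \<open>k\<close> to \<open>F k\<close> if \<open>k \<in> D\<close> and to zero otherwise. It is
  independent of the representative when \<open>F\<close>, extended by zero outside \<open>D\<close>, respects the relations
  of the source. Restricting to \<open>D\<close> is what makes a map that is only given on words of one fixed
  length well defined, since a class of that degree also has representatives that involve words of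
  other lengths.
\<close>

definition lift :: "('x \<Rightarrow>\<^sub>0 'k::field) set \<Rightarrow> 'y set \<Rightarrow> ('y \<Rightarrow> ('x \<Rightarrow>\<^sub>0 'k) set)
    \<Rightarrow> ('y \<Rightarrow>\<^sub>0 'k) set \<Rightarrow> ('x \<Rightarrow>\<^sub>0 'k) set" where
  "lift N D F X =
    qsum N (\<lambda>k. qscale N (Poly_Mapping.lookup (rep X) k) (F k)) (Poly_Mapping.keys (rep X) \<inter> D)"

section \<open>The tensor vector space\<close>

text \<open>
  A generator of the free space contains several entries from \<open>'a\<close>; a slot is the function that
  fills one of the entries, all others being fixed. Dividing by additivity and homogeneity in every
  slot of words (lists) gives \<open>T(A)\<close>; doing the same for pairs of words gives
  \<open>T(A) \<otimes> T(A)\<close>, the direct sum over \<open>p\<close> and \<open>q\<close> of the spaces \<open>A\<^sup>\<otimes>\<^sup>p \<otimes> A\<^sup>\<otimes>\<^sup>q\<close>.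
\<close>

definition word_slots :: "('a \<Rightarrow> 'a list) set" where
  "word_slots = {\<lambda>a. us @ a # vs | us vs. True}"

definition pair_slots :: "('a \<Rightarrow> 'a list \<times> 'a list) set" where
  "pair_slots = {\<lambda>a. (us @ a # vs, ws) | us vs ws. True} \<union> {\<lambda>a. (ws, us @ a # vs) | us vs ws. True}"

context
  fixes scale :: "'k::field \<Rightarrow> 'a::ab_group_add \<Rightarrow> 'a"
begin

definition slot_relations :: "('a \<Rightarrow> 'x) set \<Rightarrow> ('x \<Rightarrow>\<^sub>0 'k) set" where
  "slot_relations S =
     {Poly_Mapping.single (f (a + b)) 1 - Poly_Mapping.single (f a) 1 - Poly_Mapping.single (f b) 1
       | f a b. f \<in> S} \<union>
     {Poly_Mapping.single (f (scale c a)) 1 - Poly_Mapping.single (f a) c | f c a. f \<in> S}"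

definition word_rel :: "('a list \<Rightarrow>\<^sub>0 'k) set" where
  "word_rel = module.span pm_scale (slot_relations word_slots)"

definition pair_rel :: "('a list \<times> 'a list \<Rightarrow>\<^sub>0 'k) set" where
  "pair_rel = module.span pm_scale (slot_relations pair_slots)"

definition tens :: "'a list \<Rightarrow> ('a list \<Rightarrow>\<^sub>0 'k) set" where
  "tens as = coset word_rel (Poly_Mapping.single as 1)"

definition ptens :: "'a list \<Rightarrow> 'a list \<Rightarrow> ('a list \<times> 'a list \<Rightarrow>\<^sub>0 'k) set" where
  "ptens as bs = coset pair_rel (Poly_Mapping.single (as, bs) 1)"

text \<open>\<open>tpow n\<close> is \<open>A\<^sup>\<otimes>\<^sup>n\<close>; \<open>ppow n\<close> is the direct sum of all \<open>A\<^sup>\<otimes>\<^sup>p \<otimes> A\<^sup>\<otimes>\<^sup>q\<close> with \<open>p + q = n\<close>.\<close>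

definition tpow :: "nat \<Rightarrow> ('a list \<Rightarrow>\<^sub>0 'k) set set" where
  "tpow n = {coset word_rel x | x. Poly_Mapping.keys x \<subseteq> {as. length as = n}}"

definition ppow :: "nat \<Rightarrow> ('a list \<times> 'a list \<Rightarrow>\<^sub>0 'k) set set" where
  "ppow n = {coset pair_rel x | x. Poly_Mapping.keys x \<subseteq> {(as, bs). length as + length bs = n}}"

abbreviation tlift :: "nat \<Rightarrow> ('a list \<Rightarrow> ('a list \<Rightarrow>\<^sub>0 'k) set)
    \<Rightarrow> ('a list \<Rightarrow>\<^sub>0 'k) set \<Rightarrow> ('a list \<Rightarrow>\<^sub>0 'k) set" where
  "tlift n \<equiv> lift word_rel {as. length as = n}"

text \<open>
  \<open>otimes\<close> is the canonical map \<open>T(A) \<times> T(A) \<rightarrow> T(A) \<otimes> T(A)\<close>; \<open>conc\<close> is the concatenation, which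
  identifies \<open>A\<^sup>\<otimes>\<^sup>p \<otimes> A\<^sup>\<otimes>\<^sup>q\<close> with \<open>A\<^sup>\<otimes>\<^sup>(\<^sup>p\<^sup>+\<^sup>q\<^sup>)\<close>.
\<close>

definition otimes :: "('a list \<Rightarrow>\<^sub>0 'k) set \<Rightarrow> ('a list \<Rightarrow>\<^sub>0 'k) set \<Rightarrow> ('a list \<times> 'a list \<Rightarrow>\<^sub>0 'k) set" where
  "otimes X Y = lift pair_rel UNIV (\<lambda>as. lift pair_rel UNIV (\<lambda>bs. ptens as bs) Y) X"

definition conc :: "('a list \<times> 'a list \<Rightarrow>\<^sub>0 'k) set \<Rightarrow> ('a list \<Rightarrow>\<^sub>0 'k) set" where
  "conc = lift word_rel UNIV (\<lambda>(as, bs). tens (as @ bs))"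

text \<open>\<open>tmap p q f g\<close> is \<open>f \<otimes> g\<close> on \<open>A\<^sup>\<otimes>\<^sup>(\<^sup>p\<^sup>+\<^sup>q\<^sup>)\<close>, for \<open>f\<close> and \<open>g\<close> linear on \<open>A\<^sup>\<otimes>\<^sup>p\<close> and \<open>A\<^sup>\<otimes>\<^sup>q\<close>.\<close>

definition tmap :: "nat \<Rightarrow> nat
    \<Rightarrow> (('a list \<Rightarrow>\<^sub>0 'k) set \<Rightarrow> ('a list \<Rightarrow>\<^sub>0 'k) set)
    \<Rightarrow> (('a list \<Rightarrow>\<^sub>0 'k) set \<Rightarrow> ('a list \<Rightarrow>\<^sub>0 'k) set)
    \<Rightarrow> ('a list \<Rightarrow>\<^sub>0 'k) set \<Rightarrow> ('a list \<Rightarrow>\<^sub>0 'k) set" where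
  "tmap p q f g =
     tlift (p + q) (\<lambda>as. conc (otimes (f (tens (take p as))) (g (tens (drop p as)))))"

definition tensor_aut :: "nat \<Rightarrow> (('a list \<Rightarrow>\<^sub>0 'k) set \<Rightarrow> ('a list \<Rightarrow>\<^sub>0 'k) set) \<Rightarrow> bool" where
  "tensor_aut n f \<longleftrightarrow> bij_betw f (tpow n) (tpow n) \<and>
     (\<forall>X\<in>tpow n. \<forall>Y\<in>tpow n. f (qadd word_rel X Y) = qadd word_rel (f X) (f Y)) \<and>
     (\<forall>c. \<forall>X\<in>tpow n. f (qscale word_rel c X) = qscale word_rel c (f X))"

section \<open>Product and unit\<close>

definition mul_map :: "('a \<Rightarrow> 'a \<Rightarrow> 'a) \<Rightarrow> ('a list \<Rightarrow>\<^sub>0 'k) set \<Rightarrow> ('a list \<Rightarrow>\<^sub>0 'k) set" where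
  "mul_map mul = tlift 2 (\<lambda>as. tens [mul (as ! 0) (as ! 1)])"

text \<open>\<open>mul_pow mul n\<close> is \<open>\<mu>\<^sup>\<otimes>\<^sup>n\<close>, with \<open>(A \<otimes> A)\<^sup>\<otimes>\<^sup>n\<close> identified with \<open>A\<^sup>\<otimes>\<^sup>2\<^sup>n\<close>.\<close>

fun mul_pow :: "('a \<Rightarrow> 'a \<Rightarrow> 'a) \<Rightarrow> nat \<Rightarrow> ('a list \<Rightarrow>\<^sub>0 'k) set \<Rightarrow> ('a list \<Rightarrow>\<^sub>0 'k) set" where
  "mul_pow mul 0 = id"
| "mul_pow mul (Suc n) = tmap 2 (2 * n) (mul_map mul) (mul_pow mul n)"

text \<open>\<open>insert_unit one p i\<close> is \<open>s'\<^sub>i : A\<^sup>\<otimes>\<^sup>p \<rightarrow> A\<^sup>\<otimes>\<^sup>p\<^sup>+\<^sup>1\<close>.\<close>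

definition insert_unit :: "'a \<Rightarrow> nat \<Rightarrow> nat \<Rightarrow> ('a list \<Rightarrow>\<^sub>0 'k) set \<Rightarrow> ('a list \<Rightarrow>\<^sub>0 'k) set" where
  "insert_unit one p i = tlift p (\<lambda>as. tens (take i as @ [one] @ drop i as))"

text \<open>On \<open>A\<^sup>\<otimes>\<^sup>p\<close>, the list \<open>[i\<^sub>1, \<dots>, i\<^sub>r]\<close> stands for \<open>s'\<^bsub>i\<^sub>r\<^esub> \<cdots> s'\<^bsub>i\<^sub>1\<^esub>\<close>: its head is applied first.\<close>

fun insert_units :: "'a \<Rightarrow> nat \<Rightarrow> nat list \<Rightarrow> ('a list \<Rightarrow>\<^sub>0 'k) set \<Rightarrow> ('a list \<Rightarrow>\<^sub>0 'k) set" where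
  "insert_units one p [] = id"
| "insert_units one p (i # is) = insert_units one (Suc p) is \<circ> insert_unit one p i"

section \<open>Action of words in the generators\<close>

text \<open>\<open>sigma_at \<sigma> n i\<close> is \<open>\<sigma>\<^sub>i\<close> on \<open>A\<^sup>\<otimes>\<^sup>n\<close>, for \<open>0 < i < n\<close>.\<close>

definition sigma_at :: "(('a list \<Rightarrow>\<^sub>0 'k) set \<Rightarrow> ('a list \<Rightarrow>\<^sub>0 'k) set) \<Rightarrow> nat \<Rightarrow> nat
    \<Rightarrow> ('a list \<Rightarrow>\<^sub>0 'k) set \<Rightarrow> ('a list \<Rightarrow>\<^sub>0 'k) set" where
  "sigma_at \<sigma> n i = tmap (i - 1) (n - i + 1) id (tmap 2 (n - i - 1) \<sigma> id)"

text \<open>The list \<open>[i\<^sub>1, \<dots>, i\<^sub>r]\<close> stands for \<open>\<sigma>\<^bsub>i\<^sub>1\<^esub> \<cdots> \<sigma>\<^bsub>i\<^sub>r\<^esub>\<close>: its last entry is applied first.\<close>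

definition sigma_word :: "(('a list \<Rightarrow>\<^sub>0 'k) set \<Rightarrow> ('a list \<Rightarrow>\<^sub>0 'k) set) \<Rightarrow> nat \<Rightarrow> nat list
    \<Rightarrow> ('a list \<Rightarrow>\<^sub>0 'k) set \<Rightarrow> ('a list \<Rightarrow>\<^sub>0 'k) set" where
  "sigma_word \<sigma> n is = foldr (\<lambda>i f. sigma_at \<sigma> n i \<circ> f) is id"

end

definition perm_word :: "nat list \<Rightarrow> nat \<Rightarrow> nat" where
  "perm_word is = foldr (\<lambda>i f. Transposition.transpose i (Suc i) \<circ> f) is id"

definition reduced_word :: "nat \<Rightarrow> (nat \<Rightarrow> nat) \<Rightarrow> nat list \<Rightarrow> bool" where
  "reduced_word n w is \<longleftrightarrow> set is \<subseteq> {1..<n} \<and> perm_word is = w \<and>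
     (\<forall>js. set js \<subseteq> {1..<n} \<and> perm_word js = w \<longrightarrow> length is \<le> length js)"

definition shuffle_perms :: "nat \<Rightarrow> nat \<Rightarrow> (nat \<Rightarrow> nat) set" where
  "shuffle_perms p n =
     {w. w permutes {1..n} \<and> strict_mono_on {1..p} w \<and> strict_mono_on {p + 1..n} w}"

context
  fixes scale :: "'k::field \<Rightarrow> 'a::ab_group_add \<Rightarrow> 'a"
begin

text \<open>
  The choice of the reduced decomposition does not matter when \<open>\<sigma>\<close> satisfies the braid equation.
\<close>

definition T_perm :: "(('a list \<Rightarrow>\<^sub>0 'k) set \<Rightarrow> ('a list \<Rightarrow>\<^sub>0 'k) set) \<Rightarrow> nat \<Rightarrow> (nat \<Rightarrow> nat)
    \<Rightarrow> ('a list \<Rightarrow>\<^sub>0 'k) set \<Rightarrow> ('a list \<Rightarrow>\<^sub>0 'k) set" where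
  "T_perm \<sigma> n w = sigma_word scale \<sigma> n (SOME is. reduced_word n w is)"

section \<open>The quantum shuffle product and its factorization\<close>

text \<open>
  If one of the words is empty, the product is multiplication by a scalar, so that the
  empty word, which is the unit of \<open>A\<^sup>\<otimes>\<^sup>0 = K\<close>, acts as the identity.
\<close>

definition quantum_shuffle :: "(('a list \<Rightarrow>\<^sub>0 'k) set \<Rightarrow> ('a list \<Rightarrow>\<^sub>0 'k) set)
    \<Rightarrow> ('a list \<times> 'a list \<Rightarrow>\<^sub>0 'k) set \<Rightarrow> ('a list \<Rightarrow>\<^sub>0 'k) set" where
  "quantum_shuffle \<sigma> = lift (word_rel scale) UNIV (\<lambda>(as, bs).
     if as = [] then tens scale bs
     else if bs = [] then tens scale as
     else let p = length as; n = length as + length bs in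
       qsum (word_rel scale)
         (\<lambda>w. qscale (word_rel scale) (of_int (sign w))
                (T_perm \<sigma> n w (conc scale (ptens scale as bs))))
         (shuffle_perms p n))"

text \<open>\<open>g_map one n\<close> is \<open>g'\<close> on the direct sum of all \<open>A\<^sup>\<otimes>\<^sup>p \<otimes> A\<^sup>\<otimes>\<^sup>q\<close> with \<open>p + q = n\<close>.\<close>

definition g_map :: "'a \<Rightarrow> nat \<Rightarrow> ('a list \<times> 'a list \<Rightarrow>\<^sub>0 'k) set \<Rightarrow> ('a list \<times> 'a list \<Rightarrow>\<^sub>0 'k) set" where
  "g_map one n = lift (pair_rel scale) {(as, bs). length as + length bs = n} (\<lambda>(as, bs).
     let p = length as in
       qsum (pair_rel scale)
         (\<lambda>w. qscale (pair_rel scale) (of_int (sign w))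
           (otimes scale
             (insert_units scale one p (map (\<lambda>j. w j - 1) [p + 1..<n + 1]) (tens scale as))
             (insert_units scale one (n - p) (map (\<lambda>j. w j - 1) [1..<p + 1]) (tens scale bs))))
         (shuffle_perms p n))"

text \<open>
  The factors of \<open>\<psi>\<^sub>m\<close> are \<open>\<sigma>\<^bsub>2k\<^esub> \<cdots> \<sigma>\<^bsub>m+1+k\<^esub>\<close> for \<open>k = 1, \<dots>, m + 1\<close>, the one for \<open>k = 1\<close> being
  applied first. They act on \<open>A\<^sup>\<otimes>\<^sup>2\<^sup>m\<^sup>+\<^sup>4\<close>, with which both the source and the target of \<open>\<psi>\<^sub>m\<close> are
  identified.
\<close>

definition psi :: "(('a list \<Rightarrow>\<^sub>0 'k) set \<Rightarrow> ('a list \<Rightarrow>\<^sub>0 'k) set) \<Rightarrow> nat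
    \<Rightarrow> ('a list \<Rightarrow>\<^sub>0 'k) set \<Rightarrow> ('a list \<Rightarrow>\<^sub>0 'k) set" where
  "psi \<sigma> m = sigma_word scale \<sigma> (2 * m + 4)
     (concat (map (\<lambda>k. [2 * k..<m + k + 2]) (rev [1..<m + 2])))"

definition Theta :: "(('a list \<Rightarrow>\<^sub>0 'k) set \<Rightarrow> ('a list \<Rightarrow>\<^sub>0 'k) set) \<Rightarrow> 'a \<Rightarrow> nat
    \<Rightarrow> ('a list \<times> 'a list \<Rightarrow>\<^sub>0 'k) set \<Rightarrow> ('a list \<Rightarrow>\<^sub>0 'k) set" where
  "Theta \<sigma> one n = (if n < 2 then id else psi \<sigma> (n - 2)) \<circ> conc scale \<circ> g_map one n"

end

end

theory Submission
  imports Defs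
begin

text \<open>
  In a summand of \<open>\<Theta>\<close> each of the \<open>n\<close> pairs of neighbouring factors consists of one unit and one
  factor that comes from the given words. Since \<open>\<sigma>\<close> just
  flips a unit with its neighbour, the units can be deleted from \<open>\<psi> \<circ> g'\<close>: the transpositions that
  move a unit disappear, and the remaining ones are moved to smaller indices. What remains is the
  action of a word for the shuffle \<open>w\<close>, and \<open>\<mu>\<^sup>\<otimes>\<close> absorbs the units. This word is reduced, because
  every letter increases the sum of the images of the first block by one. As a shuffle is fully
  commutative, its reduced words differ by commutations only, so the word acts as \<open>T\<^sub>\<sigma>(w)\<close>.
\<close>

section \<open>Linear maps between quotients of free vector spaces\<close>

text \<open>\<open>\<sigma>\<close> sends a pure tensor to a sum of pure tensors, so a word in the
  braidings cannot be followed letter by letter. Inserting units is therefore turned into a linear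
  map along a pattern, through which one braiding at a time is moved; the pattern, a plain list, is
  all that is tracked. The factors of \<open>\<psi>\<close> only carry entries of the second half
  leftwards across entries of the first half, so two letters of the same word never meet: a
  surviving transposition exchanges a letter of the first word with one of the second. This is the
  reason why the sum over the image of the first block rises at every letter. An arbitrary
  transposition raises this sum by at most one, which bounds the length of every word for the same
  permutation from below. \<open>T_perm\<close> takes an unspecified reduced word; it attains the
  same bound, so only ascending words have to be compared. Tensor spaces are sets of cosets, hence
  linearity is a predicate and each identity is reduced to pure tensors through it.\<close>

lemma lookup_pm_scale [simp]: "Poly_Mapping.lookup (pm_scale c x) k = c * Poly_Mapping.lookup x k"
  by (simp add: pm_scale_def Poly_Mapping.map.rep_eq when_def)

interpretation pm: vector_space "pm_scale :: 'k::field \<Rightarrow> ('x \<Rightarrow>\<^sub>0 'k) \<Rightarrow> ('x \<Rightarrow>\<^sub>0 'k)"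
  by unfold_locales (auto intro!: poly_mapping_eqI simp: lookup_add algebra_simps)

interpretation pmp: vector_space_pair "pm_scale :: 'k::field \<Rightarrow> ('x \<Rightarrow>\<^sub>0 'k) \<Rightarrow> ('x \<Rightarrow>\<^sub>0 'k)"
  "pm_scale :: 'k::field \<Rightarrow> ('y \<Rightarrow>\<^sub>0 'k) \<Rightarrow> ('y \<Rightarrow>\<^sub>0 'k)"
  by unfold_locales

abbreviation pm_linear :: "(('x \<Rightarrow>\<^sub>0 'k::field) \<Rightarrow> ('y \<Rightarrow>\<^sub>0 'k)) \<Rightarrow> bool" where
  "pm_linear \<equiv> Vector_Spaces.linear pm_scale pm_scale"

lemma pm_scale_single [simp]:
  "pm_scale c (Poly_Mapping.single k d) = Poly_Mapping.single k (c * d)"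
  by (rule poly_mapping_eqI) (simp add: lookup_single when_def)

lemma keys_pm_scale: "Poly_Mapping.keys (pm_scale c x) \<subseteq> Poly_Mapping.keys x"
  by (auto simp: in_keys_iff)

lemma keys_sum_scale:
  assumes "\<And>i. i \<in> I \<Longrightarrow> Poly_Mapping.keys (x i) \<subseteq> E"
  shows "Poly_Mapping.keys (\<Sum>i\<in>I. pm_scale (c i) (x i)) \<subseteq> E"
proof (rule order_trans[OF keys_sum UN_least])
  fix i assume "i \<in> I"
  then show "Poly_Mapping.keys (pm_scale (c i) (x i)) \<subseteq> E"
    by (rule order_trans[OF keys_pm_scale assms])
qed

section \<open>Linear extension from generators\<close>

definition linear_ext :: "('y \<Rightarrow> ('x \<Rightarrow>\<^sub>0 'k::field)) \<Rightarrow> ('y \<Rightarrow>\<^sub>0 'k) \<Rightarrow> ('x \<Rightarrow>\<^sub>0 'k)" where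
  "linear_ext \<phi> x = (\<Sum>k\<in>Poly_Mapping.keys x. pm_scale (Poly_Mapping.lookup x k) (\<phi> k))"

text \<open>Coefficients outside the support vanish. Sums for several arguments, whose supports
  differ, can thus be taken over one common index set.\<close>

lemma linear_ext_superset:
  assumes "finite K" "Poly_Mapping.keys x \<subseteq> K"
  shows "linear_ext \<phi> x = (\<Sum>k\<in>K. pm_scale (Poly_Mapping.lookup x k) (\<phi> k))"
  unfolding linear_ext_def using assms
  by (intro sum.mono_neutral_left) (auto simp: in_keys_iff)

lemma linear_linear_ext:
  fixes \<phi> :: "'y \<Rightarrow> ('x \<Rightarrow>\<^sub>0 'k::field)"
  shows "pm_linear (linear_ext \<phi>)"
  unfolding Vector_Spaces.linear_iff
proof (intro conjI allI pm.vector_space_axioms)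
  fix x y :: "'y \<Rightarrow>\<^sub>0 'k" and c :: 'k
  let ?K = "Poly_Mapping.keys x \<union> Poly_Mapping.keys y"
  have "Poly_Mapping.keys (x + y) \<subseteq> ?K" by (rule keys_add)
  then show "linear_ext \<phi> (x + y) = linear_ext \<phi> x + linear_ext \<phi> y"
    by (subst (1 2 3) linear_ext_superset[of ?K])
      (auto simp: lookup_add pm.scale_left_distrib sum.distrib)
  show "linear_ext \<phi> (pm_scale c x) = pm_scale c (linear_ext \<phi> x)"
    by (subst (1 2) linear_ext_superset[of "Poly_Mapping.keys x"])
      (use keys_pm_scale[of c x] in \<open>auto simp: pm.scale_sum_right\<close>)
qed

lemma linear_ext_single [simp]: "linear_ext \<phi> (Poly_Mapping.single k c) = pm_scale c (\<phi> k)"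
  by (cases "c = 0") (auto simp: linear_ext_def)

lemma keys_linear_ext:
  "(\<And>k. k \<in> Poly_Mapping.keys x \<Longrightarrow> Poly_Mapping.keys (\<phi> k) \<subseteq> E) \<Longrightarrow>
    Poly_Mapping.keys (linear_ext \<phi> x) \<subseteq> E"
  unfolding linear_ext_def by (rule keys_sum_scale)

lemma sum_singles:
  "(\<Sum>k\<in>Poly_Mapping.keys x. Poly_Mapping.single k (Poly_Mapping.lookup x k)) = (x :: 'y \<Rightarrow>\<^sub>0 'k::field)"
  by (rule poly_mapping_eqI) (auto simp: lookup_sum lookup_single when_def in_keys_iff sum.delta')

lemma linear_ext_single_one: "linear_ext (\<lambda>k. Poly_Mapping.single k 1) x = x"
  unfolding linear_ext_def by (simp add: sum_singles)

lemma linear_eq_linear_ext: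
  assumes "pm_linear \<Phi>"
  shows "\<Phi> x = linear_ext (\<lambda>k. \<Phi> (Poly_Mapping.single k 1)) x"
proof -
  have "\<Phi> x = \<Phi> (linear_ext (\<lambda>k. Poly_Mapping.single k 1) x)"
    by (simp add: linear_ext_single_one)
  then show ?thesis
    by (simp add: linear_ext_def pmp.linear_sum[OF assms] pmp.linear_scale[OF assms]
        del: pm_scale_single)
qed

section \<open>Calculus of cosets\<close>

lemma coset_eq_iff:
  assumes "pm.subspace N"
  shows "coset N x = coset N y \<longleftrightarrow> x - y \<in> N"
proof
  assume "coset N x = coset N y"
  moreover have "x \<in> coset N x"
    unfolding coset_def using pm.subspace_0[OF assms] by force
  ultimately obtain d where "d \<in> N" "x = y + d" by (auto simp: coset_def)
  then show "x - y \<in> N" by simp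
next
  have sub: "coset N x \<subseteq> coset N y" if "x - y \<in> N" for x y
  proof
    fix z assume "z \<in> coset N x"
    then obtain d where "d \<in> N" "z = x + d" by (auto simp: coset_def)
    then have "z = y + ((x - y) + d)" "(x - y) + d \<in> N"
      using that pm.subspace_add[OF assms that] by simp_all
    then show "z \<in> coset N y" unfolding coset_def by (rule image_eqI)
  qed
  assume "x - y \<in> N"
  moreover from this have "y - x \<in> N" using pm.subspace_neg[OF assms] by fastforce
  ultimately show "coset N x = coset N y" using sub by blast
qed

text \<open>\<open>rep\<close> is an arbitrary choice; that it stays in the given coset is the
  property on which the well-definedness of \<open>qadd\<close>, \<open>qscale\<close>,
  \<open>qsum\<close> and \<open>lift\<close> rests.\<close>

lemma coset_rep:
  assumes "pm.subspace N"
  shows "coset N (rep (coset N x)) = coset N x"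
proof -
  have "x \<in> coset N x"
    unfolding coset_def using pm.subspace_0[OF assms] by force
  then have "rep (coset N x) \<in> coset N x" unfolding rep_def by (rule someI)
  then show ?thesis unfolding coset_eq_iff[OF assms] by (auto simp: coset_def)
qed

lemma coset_add_cong:
  assumes "pm.subspace N" "coset N x = coset N x'" "coset N y = coset N y'"
  shows "coset N (x + y) = coset N (x' + y')"
proof -
  have "(x + y) - (x' + y') = (x - x') + (y - y')" by simp
  then show ?thesis
    using assms by (simp only: coset_eq_iff) (metis pm.subspace_add)
qed

lemma coset_scale_cong:
  assumes "pm.subspace N" "coset N x = coset N x'"
  shows "coset N (pm_scale c x) = coset N (pm_scale c x')"
  using assms by (metis coset_eq_iff pm.scale_right_diff_distrib pm.subspace_scale)

lemma coset_sum_cong: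
  assumes "pm.subspace N" "\<And>i. i \<in> I \<Longrightarrow> coset N (x i) = coset N (y i)"
  shows "coset N (sum x I) = coset N (sum y I)"
  using assms(2)
proof (induction I rule: infinite_finite_induct)
  case (insert i I)
  then have "coset N (x i + sum x I) = coset N (y i + sum y I)"
    by (intro coset_add_cong[OF assms(1)]) simp_all
  then show ?case using insert.hyps by simp
qed simp_all

lemma qadd_coset [simp]:
  "pm.subspace N \<Longrightarrow> qadd N (coset N x) (coset N y) = coset N (x + y)"
  unfolding qadd_def by (intro coset_add_cong coset_rep)

lemma qscale_coset [simp]:
  "pm.subspace N \<Longrightarrow> qscale N c (coset N x) = coset N (pm_scale c x)"
  unfolding qscale_def by (intro coset_scale_cong coset_rep)

lemma qsum_coset [simp]:
  "pm.subspace N \<Longrightarrow> qsum N (\<lambda>i. coset N (x i)) I = coset N (sum x I)"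
  unfolding qsum_def by (intro coset_sum_cong coset_rep)

lemma qsum_cong:
  "(\<And>i. i \<in> I \<Longrightarrow> X i = Y i) \<Longrightarrow> qsum N X I = qsum N Y I"
  unfolding qsum_def by (auto intro!: arg_cong[of _ _ "coset N"] sum.cong)

lemma qsum_coset':
  assumes "pm.subspace N" "\<And>i. i \<in> I \<Longrightarrow> X i = coset N (x i)"
  shows "qsum N X I = coset N (sum x I)"
  using qsum_coset[OF assms(1)] qsum_cong[of I X] assms(2) by metis

text \<open>The image in the quotient of the span of the generators in \<open>E\<close>.
  \<open>tpow\<close> and \<open>ppow\<close> are of this form, and \<open>E = UNIV\<close> gives
  the whole quotient.\<close>

definition qcar :: "('x \<Rightarrow>\<^sub>0 'k::field) set \<Rightarrow> 'x set \<Rightarrow> ('x \<Rightarrow>\<^sub>0 'k) set set" where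
  "qcar N E = {coset N x | x. Poly_Mapping.keys x \<subseteq> E}"

text \<open>
  Linearity between quotients is expressed by a lift to the free spaces, which are types with
  an addition, unlike the quotients.
\<close>

definition qlinear :: "('y \<Rightarrow>\<^sub>0 'k::field) set \<Rightarrow> 'y set \<Rightarrow> ('x \<Rightarrow>\<^sub>0 'k) set \<Rightarrow> 'x set
    \<Rightarrow> (('y \<Rightarrow>\<^sub>0 'k) set \<Rightarrow> ('x \<Rightarrow>\<^sub>0 'k) set) \<Rightarrow> bool" where
  "qlinear M D N E f \<longleftrightarrow> (\<exists>\<Phi>. pm_linear \<Phi> \<and>
     (\<forall>x. Poly_Mapping.keys x \<subseteq> D \<longrightarrow>
        Poly_Mapping.keys (\<Phi> x) \<subseteq> E \<and> f (coset M x) = coset N (\<Phi> x)))"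

lemma qcarI: "Poly_Mapping.keys x \<subseteq> E \<Longrightarrow> coset N x \<in> qcar N E"
  by (auto simp: qcar_def)

lemma qcarE:
  assumes "X \<in> qcar N E"
  obtains x where "Poly_Mapping.keys x \<subseteq> E" "X = coset N x"
  using assms by (auto simp: qcar_def)

lemma qlinearE:
  assumes "qlinear M D N E f"
  obtains \<Phi> where "pm_linear \<Phi>"
    "\<And>x. Poly_Mapping.keys x \<subseteq> D \<Longrightarrow> Poly_Mapping.keys (\<Phi> x) \<subseteq> E"
    "\<And>x. Poly_Mapping.keys x \<subseteq> D \<Longrightarrow> f (coset M x) = coset N (\<Phi> x)"
  using assms unfolding qlinear_def by blast

lemma qlinear_car: "qlinear M D N E f \<Longrightarrow> X \<in> qcar M D \<Longrightarrow> f X \<in> qcar N E"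
  by (auto elim!: qlinearE qcarE intro!: qcarI)

lemma qlinear_weaken:
  assumes "qlinear M D N E f" "D' \<subseteq> D" "E \<subseteq> E'"
  shows "qlinear M D' N E' f"
  using assms unfolding qlinear_def by (meson subset_trans)

lemma qlinear_id: "qlinear M D M D id"
  unfolding qlinear_def using pm.linear_id by (intro exI[of _ id]) auto

lemma qlinear_compose:
  assumes "qlinear M D N E f" "qlinear N E L G g"
  shows "qlinear M D L G (\<lambda>X. g (f X))"
proof -
  obtain \<Phi> where \<Phi>: "pm_linear \<Phi>"
    "\<And>x. Poly_Mapping.keys x \<subseteq> D \<Longrightarrow> Poly_Mapping.keys (\<Phi> x) \<subseteq> E"
    "\<And>x. Poly_Mapping.keys x \<subseteq> D \<Longrightarrow> f (coset M x) = coset N (\<Phi> x)"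
    using assms(1) by (rule qlinearE) blast
  obtain \<Psi> where \<Psi>: "pm_linear \<Psi>"
    "\<And>x. Poly_Mapping.keys x \<subseteq> E \<Longrightarrow> Poly_Mapping.keys (\<Psi> x) \<subseteq> G"
    "\<And>x. Poly_Mapping.keys x \<subseteq> E \<Longrightarrow> g (coset N x) = coset L (\<Psi> x)"
    using assms(2) by (rule qlinearE) blast
  have "pm_linear (\<lambda>x. \<Psi> (\<Phi> x))"
    using \<Phi>(1) \<Psi>(1) Vector_Spaces.linear_compose[of pm_scale pm_scale \<Phi> pm_scale \<Psi>]
    by (simp add: o_def)
  then show ?thesis
    unfolding qlinear_def using \<Phi> \<Psi> by (intro exI[of _ "\<lambda>x. \<Psi> (\<Phi> x)"]) auto
qed

text \<open>The two lifts may differ on a generator by an element of \<open>N\<close>; after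
  expanding both in generators, the total difference is still in \<open>N\<close>. This is the
  principle by which identities of tensors are checked on pure tensors only.\<close>

lemma qlinear_eqI:
  assumes "qlinear M D N E f" "qlinear M D N E' g"
    and "\<And>k. k \<in> D \<Longrightarrow>
      f (coset M (Poly_Mapping.single k 1)) = g (coset M (Poly_Mapping.single k 1))"
    and N: "pm.subspace N" and X: "X \<in> qcar M D"
  shows "f X = g X"
proof -
  obtain \<Phi> where \<Phi>: "pm_linear \<Phi>"
    "\<And>x. Poly_Mapping.keys x \<subseteq> D \<Longrightarrow> f (coset M x) = coset N (\<Phi> x)"
    using assms(1) by (rule qlinearE) blast
  obtain \<Psi> where \<Psi>: "pm_linear \<Psi>"
    "\<And>x. Poly_Mapping.keys x \<subseteq> D \<Longrightarrow> g (coset M x) = coset N (\<Psi> x)"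
    using assms(2) by (rule qlinearE) blast
  obtain x where x: "Poly_Mapping.keys x \<subseteq> D" "X = coset M x" using X by (rule qcarE)
  have "coset N (\<Phi> x) = coset N (\<Psi> x)"
    unfolding linear_eq_linear_ext[OF \<Phi>(1), of x] linear_eq_linear_ext[OF \<Psi>(1), of x]
      linear_ext_def
  proof (intro coset_sum_cong coset_scale_cong N)
    fix k assume "k \<in> Poly_Mapping.keys x"
    then have "k \<in> D" using x by auto
    then show "coset N (\<Phi> (Poly_Mapping.single k 1)) = coset N (\<Psi> (Poly_Mapping.single k 1))"
      using assms(3)[of k] \<Phi>(2)[of "Poly_Mapping.single k 1"] \<Psi>(2)[of "Poly_Mapping.single k 1"]
      by simp
  qed
  then show ?thesis using \<Phi>(2) \<Psi>(2) x by simp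
qed

lemma qlinear_cong:
  assumes "qlinear M D N E f" "\<And>X. X \<in> qcar M D \<Longrightarrow> f X = g X"
  shows "qlinear M D N E g"
  using assms unfolding qlinear_def qcar_def by (metis (mono_tags, lifting) mem_Collect_eq)

lemma qlinear_qadd:
  assumes "pm.subspace M" "pm.subspace N" "qlinear M D N E f" "X \<in> qcar M D" "Y \<in> qcar M D"
  shows "f (qadd M X Y) = qadd N (f X) (f Y)"
proof -
  obtain \<Phi> where \<Phi>: "pm_linear \<Phi>"
    "\<And>x. Poly_Mapping.keys x \<subseteq> D \<Longrightarrow> f (coset M x) = coset N (\<Phi> x)"
    using assms(3) by (rule qlinearE) blast
  obtain x where x: "Poly_Mapping.keys x \<subseteq> D" "X = coset M x" using assms(4) by (rule qcarE)
  obtain y where y: "Poly_Mapping.keys y \<subseteq> D" "Y = coset M y" using assms(5) by (rule qcarE)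
  have "Poly_Mapping.keys (x + y) \<subseteq> D" using x y keys_add[of x y] by blast
  then show ?thesis using x y assms by (simp add: \<Phi>(2) pmp.linear_add[OF \<Phi>(1)])
qed

lemma qlinear_qscale:
  assumes "pm.subspace M" "pm.subspace N" "qlinear M D N E f" "X \<in> qcar M D"
  shows "f (qscale M c X) = qscale N c (f X)"
proof -
  obtain \<Phi> where \<Phi>: "pm_linear \<Phi>"
    "\<And>x. Poly_Mapping.keys x \<subseteq> D \<Longrightarrow> f (coset M x) = coset N (\<Phi> x)"
    using assms(3) by (rule qlinearE) blast
  obtain x where x: "Poly_Mapping.keys x \<subseteq> D" "X = coset M x" using assms(4) by (rule qcarE)
  have "Poly_Mapping.keys (pm_scale c x) \<subseteq> D" using x keys_pm_scale[of c x] by blast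
  then show ?thesis using x assms by (simp add: \<Phi>(2) pmp.linear_scale[OF \<Phi>(1)])
qed

lemma qlinear_qsum:
  assumes "pm.subspace M" "pm.subspace N" "qlinear M D N E f"
    and "\<And>i. i \<in> I \<Longrightarrow> X i \<in> qcar M D"
  shows "f (qsum M (\<lambda>i. qscale M (c i) (X i)) I) = qsum N (\<lambda>i. qscale N (c i) (f (X i))) I"
proof -
  obtain \<Phi> where \<Phi>: "pm_linear \<Phi>"
    "\<And>x. Poly_Mapping.keys x \<subseteq> D \<Longrightarrow> f (coset M x) = coset N (\<Phi> x)"
    using assms(3) by (rule qlinearE) blast
  have "\<forall>i. \<exists>x. i \<in> I \<longrightarrow> Poly_Mapping.keys x \<subseteq> D \<and> X i = coset M x"
    using assms(4) by (metis qcarE)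
  then obtain x where x: "\<And>i. i \<in> I \<Longrightarrow> Poly_Mapping.keys (x i) \<subseteq> D"
    "\<And>i. i \<in> I \<Longrightarrow> X i = coset M (x i)" by metis
  note keys = keys_sum_scale[of I x D c, OF x(1)]
  have "qsum M (\<lambda>i. qscale M (c i) (X i)) I = coset M (\<Sum>i\<in>I. pm_scale (c i) (x i))"
    using x(2) assms(1) by (intro qsum_coset') auto
  moreover have "qsum N (\<lambda>i. qscale N (c i) (f (X i))) I
      = coset N (\<Sum>i\<in>I. pm_scale (c i) (\<Phi> (x i)))"
    using x \<Phi>(2) assms(2) by (intro qsum_coset') auto
  ultimately show ?thesis
    using keys by (simp add: \<Phi>(2) pmp.linear_sum[OF \<Phi>(1)] pmp.linear_scale[OF \<Phi>(1)])
qed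

lemma qlinear_qsum_fun:
  assumes "pm.subspace N" "\<And>i. i \<in> I \<Longrightarrow> qlinear M D N E (f i)"
  shows "qlinear M D N E (\<lambda>X. qsum N (\<lambda>i. qscale N (c i) (f i X)) I)"
proof -
  have "\<forall>i. \<exists>\<Phi>. i \<in> I \<longrightarrow> pm_linear \<Phi> \<and>
     (\<forall>x. Poly_Mapping.keys x \<subseteq> D \<longrightarrow>
        Poly_Mapping.keys (\<Phi> x) \<subseteq> E \<and> f i (coset M x) = coset N (\<Phi> x))"
    using assms(2) unfolding qlinear_def by blast
  then obtain \<Phi> where \<Phi>: "\<And>i. i \<in> I \<Longrightarrow> pm_linear (\<Phi> i)"
    "\<And>i x. i \<in> I \<Longrightarrow> Poly_Mapping.keys x \<subseteq> D \<Longrightarrow> Poly_Mapping.keys (\<Phi> i x) \<subseteq> E"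
    "\<And>i x. i \<in> I \<Longrightarrow> Poly_Mapping.keys x \<subseteq> D \<Longrightarrow> f i (coset M x) = coset N (\<Phi> i x)"
    by metis
  let ?\<Psi> = "\<lambda>x. \<Sum>i\<in>I. pm_scale (c i) (\<Phi> i x)"
  have "pm_linear ?\<Psi>"
    using \<Phi>(1) by (intro pmp.linear_compose_sum ballI pmp.linear_compose_scale_right) auto
  moreover have "Poly_Mapping.keys (?\<Psi> x) \<subseteq> E" if "Poly_Mapping.keys x \<subseteq> D" for x
    using \<Phi>(2)[OF _ that] by (rule keys_sum_scale)
  moreover have "qsum N (\<lambda>i. qscale N (c i) (f i (coset M x))) I = coset N (?\<Psi> x)"
    if "Poly_Mapping.keys x \<subseteq> D" for x
    using \<Phi>(3) that assms(1) by (intro qsum_coset') auto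
  ultimately show ?thesis
    unfolding qlinear_def by (intro exI[of _ ?\<Psi>]) auto
qed

text \<open>Representatives of the images of generators are chosen and extended linearly; additivity
  and homogeneity make the extension a lift of \<open>f\<close>. This brings the automorphism
  \<open>\<sigma>\<close>, given only as a map of cosets, under \<open>qlinear\<close>.\<close>

lemma qlinear_if_additive:
  assumes M: "pm.subspace M" and N: "pm.subspace N"
    and car: "\<And>X. X \<in> qcar M D \<Longrightarrow> f X \<in> qcar N E"
    and add: "\<And>X Y. X \<in> qcar M D \<Longrightarrow> Y \<in> qcar M D \<Longrightarrow> f (qadd M X Y) = qadd N (f X) (f Y)"
    and scale: "\<And>c X. X \<in> qcar M D \<Longrightarrow> f (qscale M c X) = qscale N c (f X)"
  shows "qlinear M D N E f"
proof -
  have "\<forall>k. \<exists>y. Poly_Mapping.keys y \<subseteq> E \<and>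
      (k \<in> D \<longrightarrow> f (coset M (Poly_Mapping.single k 1)) = coset N y)"
  proof
    fix k
    show "\<exists>y. Poly_Mapping.keys y \<subseteq> E \<and>
      (k \<in> D \<longrightarrow> f (coset M (Poly_Mapping.single k 1)) = coset N y)"
    proof (cases "k \<in> D")
      case True
      then have "coset M (Poly_Mapping.single k 1) \<in> qcar M D" by (intro qcarI) simp
      then show ?thesis using car by (meson qcarE)
    qed (auto intro: exI[of _ 0])
  qed
  then obtain \<phi> where \<phi>: "\<And>k. Poly_Mapping.keys (\<phi> k) \<subseteq> E"
    "\<And>k. k \<in> D \<Longrightarrow> f (coset M (Poly_Mapping.single k 1)) = coset N (\<phi> k)" by metis
  have sums: "f (coset M (\<Sum>k\<in>K. Poly_Mapping.single k (c k)))
      = coset N (\<Sum>k\<in>K. pm_scale (c k) (\<phi> k))" if "finite K" "K \<subseteq> D" for K c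
    using that
  proof (induction K rule: finite_induct)
    case empty
    \<comment> \<open>The value at the zero class comes from homogeneity with the scalar 0.\<close>
    have "coset M 0 \<in> qcar M D" by (intro qcarI) simp
    then have "f (qscale M 0 (coset M 0)) = qscale N 0 (f (coset M 0))"
      and "f (coset M 0) \<in> qcar N E" using scale car by auto
    then show ?case using M N by (auto elim!: qcarE)
  next
    case (insert k K)
    have 1: "f (coset M (Poly_Mapping.single k (c k))) = coset N (pm_scale (c k) (\<phi> k))"
      using scale[OF qcarI, of "Poly_Mapping.single k 1" "c k"] \<phi>(2)[of k] insert.prems M N
      by simp
    have "Poly_Mapping.keys (\<Sum>k\<in>K. Poly_Mapping.single k (c k)) \<subseteq> D"
      using keys_sum[of "\<lambda>k. Poly_Mapping.single k (c k)" K] insert.prems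
      by (auto split: if_splits)
    then have 2: "coset M (\<Sum>k\<in>K. Poly_Mapping.single k (c k)) \<in> qcar M D" by (rule qcarI)
    have 3: "coset M (Poly_Mapping.single k (c k)) \<in> qcar M D"
      using insert.prems by (intro qcarI) (auto split: if_splits)
    show ?case using insert 1 add[OF 3 2] M N by simp
  qed
  have "f (coset M x) = coset N (linear_ext \<phi> x)" if "Poly_Mapping.keys x \<subseteq> D" for x
    using sums[OF finite_keys that, of "Poly_Mapping.lookup x"]
    by (simp add: sum_singles linear_ext_def)
  then show ?thesis
    unfolding qlinear_def
    by (intro exI[of _ "linear_ext \<phi>"] conjI allI impI linear_linear_ext keys_linear_ext \<phi>(1)) auto
qed

lemma qlinear_expand:
  assumes N: "pm.subspace N" and f: "qlinear M D N E f" and x: "Poly_Mapping.keys x \<subseteq> D"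
  shows "f (coset M x) = qsum N (\<lambda>k. qscale N (Poly_Mapping.lookup x k)
    (f (coset M (Poly_Mapping.single k 1)))) (Poly_Mapping.keys x)"
proof -
  obtain \<Phi> where \<Phi>: "pm_linear \<Phi>"
    "\<And>x. Poly_Mapping.keys x \<subseteq> D \<Longrightarrow> f (coset M x) = coset N (\<Phi> x)"
    using f by (rule qlinearE) blast
  have "qsum N (\<lambda>k. qscale N (Poly_Mapping.lookup x k)
      (f (coset M (Poly_Mapping.single k 1)))) (Poly_Mapping.keys x) = coset N (\<Phi> x)"
    unfolding linear_eq_linear_ext[OF \<Phi>(1), of x] linear_ext_def
  proof (rule qsum_coset'[OF N])
    fix k assume "k \<in> Poly_Mapping.keys x"
    then have "f (coset M (Poly_Mapping.single k 1)) = coset N (\<Phi> (Poly_Mapping.single k 1))"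
      using x by (intro \<Phi>(2)) auto
    then show "qscale N (Poly_Mapping.lookup x k) (f (coset M (Poly_Mapping.single k 1)))
        = coset N (pm_scale (Poly_Mapping.lookup x k) (\<Phi> (Poly_Mapping.single k 1)))"
      using N by simp
  qed
  then show ?thesis using \<Phi>(2)[OF x] by simp
qed

text \<open>A lift for the target \<open>E'\<close> may use generators outside \<open>E\<close> even
  where the class has a representative in \<open>E\<close>. A new lift is built from representatives
  supported in \<open>E\<close>, chosen for the generators only. It serves to sharpen the degree of
  the target.\<close>

lemma qlinear_restrict:
  assumes M: "pm.subspace M" and N: "pm.subspace N" and f: "qlinear M D N E' f"
    and E: "\<And>k. k \<in> D \<Longrightarrow> f (coset M (Poly_Mapping.single k 1)) \<in> qcar N E"
  shows "qlinear M D N E f"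
proof -
  have "\<forall>k. \<exists>y. Poly_Mapping.keys y \<subseteq> E \<and>
      (k \<in> D \<longrightarrow> f (coset M (Poly_Mapping.single k 1)) = coset N y)"
  proof
    fix k
    show "\<exists>y. Poly_Mapping.keys y \<subseteq> E \<and>
      (k \<in> D \<longrightarrow> f (coset M (Poly_Mapping.single k 1)) = coset N y)"
    proof (cases "k \<in> D")
      case True
      from qcarE[OF E[OF this]] show ?thesis by metis
    qed (auto intro: exI[of _ 0])
  qed
  then obtain \<phi> where \<phi>: "\<And>k. Poly_Mapping.keys (\<phi> k) \<subseteq> E"
    "\<And>k. k \<in> D \<Longrightarrow> f (coset M (Poly_Mapping.single k 1)) = coset N (\<phi> k)" by metis
  have "f (coset M x) = coset N (linear_ext \<phi> x)" if "Poly_Mapping.keys x \<subseteq> D" for x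
    unfolding qlinear_expand[OF N f that] linear_ext_def
    using \<phi>(2) that N by (intro qsum_coset') auto
  then show ?thesis
    unfolding qlinear_def
    by (intro exI[of _ "linear_ext \<phi>"] conjI allI impI linear_linear_ext keys_linear_ext \<phi>(1)) auto
qed

text \<open>A sum of two maps is a linear combination over the index set
  \<open>{True, False}\<close>, so closure under finite combinations suffices.\<close>

lemma qlinear_qadd_fun:
  assumes N: "pm.subspace N" and f: "qlinear M D N E f" and g: "qlinear M D N E g"
  shows "qlinear M D N E (\<lambda>X. qadd N (f X) (g X))"
proof -
  have "qlinear M D N E (\<lambda>X. if b then f X else g X)" for b using f g by (cases b) simp_all
  then have "qlinear M D N E (\<lambda>X. qsum N (\<lambda>b. qscale N 1 (if b then f X else g X)) {True, False})"
    by (rule qlinear_qsum_fun[OF N])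
  then show ?thesis
  proof (rule qlinear_cong)
    fix X assume X: "X \<in> qcar M D"
    have "f X \<in> qcar N E" "g X \<in> qcar N E" using qlinear_car X f g by blast+
    then obtain x y where "f X = coset N x" "g X = coset N y" by (meson qcarE)
    then have "qsum N (\<lambda>b. qscale N 1 (if b then f X else g X)) {True, False}
        = coset N (\<Sum>b\<in>{True, False}. if b then x else y)"
      using N by (intro qsum_coset') auto
    then show "qsum N (\<lambda>b. qscale N 1 (if b then f X else g X)) {True, False} = qadd N (f X) (g X)"
      using \<open>f X = coset N x\<close> \<open>g X = coset N y\<close> N by simp
  qed
qed

lemma qlinear_qscale_fun:
  assumes N: "pm.subspace N" and f: "qlinear M D N E f"
  shows "qlinear M D N E (\<lambda>X. qscale N c (f X))"
proof -
  have "qlinear M D N E (\<lambda>X. qsum N (\<lambda>_. qscale N c (f X)) {()})"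
    using assms by (intro qlinear_qsum_fun) auto
  then show ?thesis
  proof (rule qlinear_cong)
    fix X assume X: "X \<in> qcar M D"
    have "f X \<in> qcar N E" using qlinear_car X f by blast
    then obtain x where "f X = coset N x" by (meson qcarE)
    then have "qsum N (\<lambda>_. qscale N c (f X)) {()} = coset N (\<Sum>_\<in>{()}. pm_scale c x)"
      using N by (intro qsum_coset') auto
    then show "qsum N (\<lambda>_. qscale N c (f X)) {()} = qscale N c (f X)"
      using \<open>f X = coset N x\<close> N by simp
  qed
qed

section \<open>Multilinear functions and the universal property of tensor spaces\<close>

definition linear_into :: "('k::field \<Rightarrow> 'a::ab_group_add \<Rightarrow> 'a) \<Rightarrow> ('x \<Rightarrow>\<^sub>0 'k) set
    \<Rightarrow> ('a \<Rightarrow> ('x \<Rightarrow>\<^sub>0 'k) set) \<Rightarrow> bool" where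
  "linear_into scale N g \<longleftrightarrow> (\<forall>a b c.
     g (a + b) = qadd N (g a) (g b) \<and> g (scale c a) = qscale N c (g a))"

text \<open>This is multilinearity, for functions that are meaningful only on the generators in
  \<open>D\<close>.\<close>

definition slot_linear :: "('k::field \<Rightarrow> 'a::ab_group_add \<Rightarrow> 'a) \<Rightarrow> ('a \<Rightarrow> 'y) set \<Rightarrow> 'y set
    \<Rightarrow> ('x \<Rightarrow>\<^sub>0 'k) set \<Rightarrow> ('y \<Rightarrow> ('x \<Rightarrow>\<^sub>0 'k) set) \<Rightarrow> bool" where
  "slot_linear scale S D N F \<longleftrightarrow>
     (\<forall>f\<in>S. \<forall>a. f a \<in> D \<longrightarrow> linear_into scale N (\<lambda>b. F (f b)))"

lemma linear_into_slot:
  assumes "f \<in> S"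
  shows "linear_into scale (pm.span (slot_relations scale S))
    (\<lambda>a. coset (pm.span (slot_relations scale S)) (Poly_Mapping.single (f a) 1))"
proof -
  have "Poly_Mapping.single (f (a + b)) 1 - (Poly_Mapping.single (f a) 1 + Poly_Mapping.single (f b) 1)
      \<in> slot_relations scale S" for a b
    using assms unfolding slot_relations_def diff_diff_eq[symmetric] by blast
  moreover have "Poly_Mapping.single (f (scale c a)) 1 - Poly_Mapping.single (f a) c
      \<in> slot_relations scale S" for c a using assms unfolding slot_relations_def by blast
  ultimately show ?thesis
    unfolding linear_into_def by (simp add: coset_eq_iff pm.span_base)
qed

lemma linear_into_compose:
  assumes "pm.subspace M" "pm.subspace N" "linear_into scale M g" "qlinear M D N E G"
    and "\<And>a. g a \<in> qcar M D"
  shows "linear_into scale N (\<lambda>a. G (g a))"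
  using assms unfolding linear_into_def by (simp add: qlinear_qadd qlinear_qscale)

text \<open>The universal property of the tensor space. By the assumption on \<open>D\<close>,
  changing an entry does not leave \<open>D\<close>. So each defining relation has all its
  generators inside \<open>D\<close>, where multilinearity kills it, or all outside, where the
  extension by zero does.\<close>

lemma
  assumes M: "M = pm.span (slot_relations scale S)" and N: "pm.subspace N"
    and D: "\<And>f a b. f \<in> S \<Longrightarrow> f a \<in> D \<Longrightarrow> f b \<in> D"
    and car: "\<And>k. k \<in> D \<Longrightarrow> F k \<in> qcar N E"
    and lin: "slot_linear scale S D N F"
  shows qlinear_lift: "qlinear M UNIV N E (lift N D F)"
    and lift_single: "k \<in> D \<Longrightarrow> lift N D F (coset M (Poly_Mapping.single k 1)) = F k"
proof -
  have "\<forall>k. \<exists>y. Poly_Mapping.keys y \<subseteq> E \<and> (k \<in> D \<longrightarrow> F k = coset N y) \<and> (k \<notin> D \<longrightarrow> y = 0)"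
  proof
    fix k
    show "\<exists>y. Poly_Mapping.keys y \<subseteq> E \<and> (k \<in> D \<longrightarrow> F k = coset N y) \<and> (k \<notin> D \<longrightarrow> y = 0)"
      using car[of k] by (cases "k \<in> D") (auto elim!: qcarE)
  qed
  then obtain \<phi> where \<phi>: "\<And>k. Poly_Mapping.keys (\<phi> k) \<subseteq> E"
    "\<And>k. k \<in> D \<Longrightarrow> F k = coset N (\<phi> k)" "\<And>k. k \<notin> D \<Longrightarrow> \<phi> k = 0" by metis
  let ?\<Phi> = "linear_ext \<phi>"
  note lin\<Phi> = linear_linear_ext[of \<phi>]
  \<comment> \<open>The extension respects the relations of the source; this makes the value of
    \<open>lift\<close> independent of the representative that \<open>rep\<close> picks.\<close>
  have "?\<Phi> x \<in> N" if "x \<in> M" for x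
    using that unfolding M
  proof (induction rule: pm.span_induct_alt)
    case base
    show ?case using pm.subspace_0[OF N] by (simp add: pmp.linear_0[OF lin\<Phi>])
  next
    case (step c x y)
    have "?\<Phi> x \<in> N"
    proof -
      consider f a b where "f \<in> S" "x = Poly_Mapping.single (f (a + b)) 1
            - Poly_Mapping.single (f a) 1 - Poly_Mapping.single (f b) 1"
        | f c a where "f \<in> S"
            "x = Poly_Mapping.single (f (scale c a)) 1 - Poly_Mapping.single (f a) c"
        using step(1) unfolding slot_relations_def by blast
      then show ?thesis
      proof cases
        case (1 f a b)
        have eq: "?\<Phi> x = \<phi> (f (a + b)) - (\<phi> (f a) + \<phi> (f b))"
          by (simp add: 1 pmp.linear_diff[OF lin\<Phi>])
        show ?thesis
        proof (cases "f a \<in> D")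
          case True
          then have "f b \<in> D" "f (a + b) \<in> D" using D 1 by blast+
          moreover have "F (f (a + b)) = qadd N (F (f a)) (F (f b))"
            using lin 1 True unfolding slot_linear_def linear_into_def by blast
          ultimately have "coset N (\<phi> (f (a + b))) = coset N (\<phi> (f a) + \<phi> (f b))"
            using True \<phi>(2) N by simp
          then show ?thesis unfolding eq using coset_eq_iff[OF N] by blast
        next
          case False
          then have "f b \<notin> D" "f (a + b) \<notin> D" using D 1 by blast+
          then show ?thesis unfolding eq using False \<phi>(3) pm.subspace_0[OF N] by simp
        qed
      next
        case (2 f c a)
        have eq: "?\<Phi> x = \<phi> (f (scale c a)) - pm_scale c (\<phi> (f a))"
          by (simp add: 2 pmp.linear_diff[OF lin\<Phi>])
        show ?thesis
        proof (cases "f a \<in> D")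
          case True
          then have "f (scale c a) \<in> D" using D 2 by blast+
          moreover have "F (f (scale c a)) = qscale N c (F (f a))"
            using lin 2 True unfolding slot_linear_def linear_into_def by blast
          ultimately have "coset N (\<phi> (f (scale c a))) = coset N (pm_scale c (\<phi> (f a)))"
            using True \<phi>(2) N by simp
          then show ?thesis unfolding eq using coset_eq_iff[OF N] by blast
        next
          case False
          then have "f (scale c a) \<notin> D" using D 2 by blast+
          then show ?thesis unfolding eq using False \<phi>(3) pm.subspace_0[OF N] by simp
        qed
      qed
    qed
    then show ?case
      using step(2) N by (simp add: pmp.linear_add[OF lin\<Phi>] pmp.linear_scale[OF lin\<Phi>]
          pm.subspace_add pm.subspace_scale)
  qed
  then have \<Phi>: "coset N (?\<Phi> x) = coset N (?\<Phi> y)" if "coset M x = coset M y" for x y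
    using that coset_eq_iff[OF N] coset_eq_iff[of M] pmp.linear_diff[OF lin\<Phi>] M
    by (metis pm.subspace_span)
  have lift: "lift N D F X = coset N (?\<Phi> (rep X))" for X
  proof -
    have "lift N D F X = coset N (\<Sum>k\<in>Poly_Mapping.keys (rep X) \<inter> D.
        pm_scale (Poly_Mapping.lookup (rep X) k) (\<phi> k))"
      unfolding lift_def using \<phi>(2) N by (intro qsum_coset') auto
    also have "(\<Sum>k\<in>Poly_Mapping.keys (rep X) \<inter> D.
        pm_scale (Poly_Mapping.lookup (rep X) k) (\<phi> k)) = ?\<Phi> (rep X)"
      unfolding linear_ext_def using \<phi>(3) by (intro sum.mono_neutral_left) auto
    finally show ?thesis .
  qed
  have *: "lift N D F (coset M x) = coset N (?\<Phi> x)" for x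
    unfolding lift using M by (intro \<Phi> coset_rep) auto
  show "qlinear M UNIV N E (lift N D F)"
    unfolding qlinear_def
    by (intro exI[of _ ?\<Phi>] conjI allI impI lin\<Phi> * keys_linear_ext \<phi>(1))
  show "lift N D F (coset M (Poly_Mapping.single k 1)) = F k" if "k \<in> D"
    using that * \<phi>(2) by simp
qed


section \<open>Tensor powers\<close>

lemma subspace_word_rel [simp]: "pm.subspace (word_rel scale)"
  by (simp add: word_rel_def)

lemma subspace_pair_rel [simp]: "pm.subspace (pair_rel scale)"
  by (simp add: pair_rel_def)

abbreviation words :: "nat \<Rightarrow> 'a list set" where
  "words n \<equiv> {as. length as = n}"

lemma tpow_eq_qcar: "tpow scale n = qcar (word_rel scale) (words n)"
  by (simp add: tpow_def qcar_def)

abbreviation tlinear :: "('k::field \<Rightarrow> 'a::ab_group_add \<Rightarrow> 'a) \<Rightarrow> nat \<Rightarrow> nat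
    \<Rightarrow> (('a list \<Rightarrow>\<^sub>0 'k) set \<Rightarrow> ('a list \<Rightarrow>\<^sub>0 'k) set) \<Rightarrow> bool" where
  "tlinear scale m n \<equiv> qlinear (word_rel scale) (words m) (word_rel scale) (words n)"

lemma tens_mem_qcar: "as \<in> D \<Longrightarrow> tens scale as \<in> qcar (word_rel scale) D"
  by (simp add: tens_def qcarI)

lemma ptens_mem_qcar: "(as, bs) \<in> D \<Longrightarrow> ptens scale as bs \<in> qcar (pair_rel scale) D"
  by (simp add: ptens_def qcarI)

lemma tens_mem [simp]: "length as = n \<Longrightarrow> tens scale as \<in> tpow scale n"
  by (simp add: tpow_eq_qcar tens_mem_qcar)

lemma tpow_qcar_UNIV: "X \<in> tpow scale n \<Longrightarrow> X \<in> qcar (word_rel scale) UNIV"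
  by (auto simp: tpow_def qcar_def)

lemma tlinear_mem: "tlinear scale m n f \<Longrightarrow> X \<in> tpow scale m \<Longrightarrow> f X \<in> tpow scale n"
  unfolding tpow_eq_qcar by (rule qlinear_car)

lemma tlinear_id: "tlinear scale n n id"
  by (rule qlinear_id)

lemma tlinear_eqI:
  assumes "qlinear (word_rel scale) (words n) N E f" "qlinear (word_rel scale) (words n) N E' g"
    and "pm.subspace N" and "\<And>as. length as = n \<Longrightarrow> f (tens scale as) = g (tens scale as)"
    and "X \<in> tpow scale n"
  shows "f X = g X"
  by (rule qlinear_eqI[OF assms(1,2) _ assms(3)])
    (use assms(4,5) in \<open>simp_all add: tens_def tpow_eq_qcar\<close>)

lemma linear_into_tens: "linear_into scale (word_rel scale) (\<lambda>a. tens scale (us @ a # vs))"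
proof -
  have "(\<lambda>a. us @ a # vs) \<in> word_slots" unfolding word_slots_def by blast
  then show ?thesis unfolding word_rel_def tens_def by (rule linear_into_slot)
qed

lemma linear_into_ptens_left:
  "linear_into scale (pair_rel scale) (\<lambda>a. ptens scale (us @ a # vs) ws)"
proof -
  have "(\<lambda>a. (us @ a # vs, ws)) \<in> pair_slots" unfolding pair_slots_def by blast
  then show ?thesis unfolding pair_rel_def ptens_def by (rule linear_into_slot)
qed

lemma linear_into_ptens_right:
  "linear_into scale (pair_rel scale) (\<lambda>a. ptens scale ws (us @ a # vs))"
proof -
  have "(\<lambda>a. (ws, us @ a # vs)) \<in> pair_slots" unfolding pair_slots_def by blast
  then show ?thesis unfolding pair_rel_def ptens_def by (rule linear_into_slot)
qed

lemma slot_linear_wordsI: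
  assumes "\<And>us vs. length us + Suc (length vs) = n \<Longrightarrow> linear_into scale N (\<lambda>a. F (us @ a # vs))"
  shows "slot_linear scale word_slots (words n) N F"
  using assms by (auto simp: slot_linear_def word_slots_def)

lemma
  fixes scale :: "'k::field \<Rightarrow> 'a::ab_group_add \<Rightarrow> 'a" and F :: "'a list \<Rightarrow> ('x \<Rightarrow>\<^sub>0 'k) set"
  assumes N: "pm.subspace N"
    and car: "\<And>as. length as = n \<Longrightarrow> F as \<in> qcar N E"
    and lin: "\<And>us vs. length us + Suc (length vs) = n \<Longrightarrow>
      linear_into scale N (\<lambda>a. F (us @ a # vs))"
  shows qlinear_lift_words: "qlinear (word_rel scale) (words n) N E (lift N (words n) F)"
    and lift_words_tens: "length as = n \<Longrightarrow> lift N (words n) F (tens scale as) = F as"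
proof -
  have D: "f b \<in> words n" if "f \<in> word_slots" "f a \<in> words n" for f :: "'a \<Rightarrow> 'a list" and a b
    using that by (auto simp: word_slots_def)
  have car': "F as \<in> qcar N E" if "as \<in> words n" for as using car that by simp
  have lin': "slot_linear scale word_slots (words n) N F"
    by (rule slot_linear_wordsI) (rule lin)
  show "qlinear (word_rel scale) (words n) N E (lift N (words n) F)"
    by (rule qlinear_weaken[OF qlinear_lift[OF word_rel_def N _ car' lin']]) (use D in \<open>blast | simp\<close>)+
  show "lift N (words n) F (tens scale as) = F as" if "length as = n"
    unfolding tens_def by (rule lift_single[OF word_rel_def N _ car' lin']) (use that D in \<open>blast | simp\<close>)+
qed

lemma
  fixes scale :: "'k::field \<Rightarrow> 'a::ab_group_add \<Rightarrow> 'a" and F :: "'a list \<Rightarrow> ('x \<Rightarrow>\<^sub>0 'k) set"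
  assumes N: "pm.subspace N" and car: "\<And>as. F as \<in> qcar N E"
    and lin: "\<And>us vs. linear_into scale N (\<lambda>a. F (us @ a # vs))"
  shows qlinear_lift_all_words: "qlinear (word_rel scale) UNIV N E (lift N UNIV F)"
    and lift_all_words_tens: "lift N UNIV F (tens scale as) = F as"
proof -
  have lin': "slot_linear scale word_slots UNIV N F"
    using lin by (auto simp: slot_linear_def word_slots_def)
  show "qlinear (word_rel scale) UNIV N E (lift N UNIV F)"
    by (rule qlinear_lift[OF word_rel_def N _ car lin']) simp
  show "lift N UNIV F (tens scale as) = F as"
    unfolding tens_def by (rule lift_single[OF word_rel_def N _ car lin']) simp_all
qed

lemma
  fixes scale :: "'k::field \<Rightarrow> 'a::ab_group_add \<Rightarrow> 'a"
    and F :: "'a list \<times> 'a list \<Rightarrow> ('x \<Rightarrow>\<^sub>0 'k) set"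
  assumes N: "pm.subspace N"
    and D: "\<And>us vs ws a b. (us @ a # vs, ws) \<in> D \<Longrightarrow> (us @ b # vs, ws) \<in> D"
      "\<And>us vs ws a b. (ws, us @ a # vs) \<in> D \<Longrightarrow> (ws, us @ b # vs) \<in> D"
    and car: "\<And>as bs. (as, bs) \<in> D \<Longrightarrow> F (as, bs) \<in> qcar N E"
    and lin: "\<And>us vs ws a. (us @ a # vs, ws) \<in> D \<Longrightarrow>
        linear_into scale N (\<lambda>a. F (us @ a # vs, ws))"
      "\<And>us vs ws a. (ws, us @ a # vs) \<in> D \<Longrightarrow>
        linear_into scale N (\<lambda>a. F (ws, us @ a # vs))"
  shows qlinear_lift_pairs: "qlinear (pair_rel scale) UNIV N E (lift N D F)"
    and lift_pairs_ptens: "(as, bs) \<in> D \<Longrightarrow> lift N D F (ptens scale as bs) = F (as, bs)"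
proof -
  have D': "f b \<in> D" if "f \<in> pair_slots" "f a \<in> D" for f :: "'a \<Rightarrow> 'a list \<times> 'a list" and a b
    using that D unfolding pair_slots_def by blast
  have car': "F k \<in> qcar N E" if "k \<in> D" for k using car that by (cases k) simp
  have lin': "slot_linear scale pair_slots D N F"
    using lin unfolding slot_linear_def pair_slots_def by blast
  show "qlinear (pair_rel scale) UNIV N E (lift N D F)"
    by (rule qlinear_lift[OF pair_rel_def N _ car' lin']) (rule D')
  show "(as, bs) \<in> D \<Longrightarrow> lift N D F (ptens scale as bs) = F (as, bs)"
    unfolding ptens_def by (rule lift_single[OF pair_rel_def N _ car' lin']) (rule D')
qed

subsection \<open>Concatenation\<close>

lemma
  shows qlinear_otimes_tens: "qlinear (word_rel scale) UNIV (pair_rel scale) UNIV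
      (lift (pair_rel scale) UNIV (ptens scale as))"
    and lift_ptens_tens: "lift (pair_rel scale) UNIV (ptens scale as) (tens scale bs)
      = ptens scale as bs"
  by (rule qlinear_lift_all_words lift_all_words_tens[where E = UNIV],
      simp_all add: ptens_mem_qcar linear_into_ptens_right)+

text \<open>As \<open>otimes\<close> is a lift inside a lift, the outer one needs the inner one to
  be multilinear in \<open>as\<close>. For general \<open>Y\<close> this is an identity between
  linear maps of \<open>Y\<close>, which need only be compared on pure tensors.\<close>

lemma
  fixes scale :: "'k::field \<Rightarrow> 'a::ab_group_add \<Rightarrow> 'a"
  assumes Y: "Y \<in> qcar (word_rel scale) UNIV"
  shows qlinear_otimes_left: "qlinear (word_rel scale) UNIV (pair_rel scale) UNIV
      (\<lambda>X. otimes scale X Y)"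
    and otimes_tens_left: "otimes scale (tens scale as) Y
      = lift (pair_rel scale) UNIV (ptens scale as) Y"
proof -
  let ?R = "\<lambda>as. lift (pair_rel scale) UNIV (ptens scale as)"
  note Q = qlinear_otimes_tens[of scale]
  note eqI = qlinear_eqI[OF Q _ _ subspace_pair_rel Y]
  have car: "?R as Y \<in> qcar (pair_rel scale) UNIV" for as
    using Q Y by (rule qlinear_car)
  have lin: "linear_into scale (pair_rel scale) (\<lambda>a. ?R (us @ a # vs) Y)" for us vs
  proof -
    have add: "?R (us @ (a + b) # vs) Y
        = qadd (pair_rel scale) (?R (us @ a # vs) Y) (?R (us @ b # vs) Y)" for a b
    proof (rule eqI[OF qlinear_qadd_fun[OF subspace_pair_rel Q Q]])
      fix bs
      show "?R (us @ (a + b) # vs) (coset (word_rel scale) (Poly_Mapping.single bs 1))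
        = qadd (pair_rel scale) (?R (us @ a # vs) (coset (word_rel scale) (Poly_Mapping.single bs 1)))
          (?R (us @ b # vs) (coset (word_rel scale) (Poly_Mapping.single bs 1)))"
        unfolding tens_def[symmetric] lift_ptens_tens
        using linear_into_ptens_left unfolding linear_into_def by blast
    qed
    have scale: "?R (us @ scale c a # vs) Y
        = qscale (pair_rel scale) c (?R (us @ a # vs) Y)" for a c
    proof (rule eqI[OF qlinear_qscale_fun[OF subspace_pair_rel Q]])
      fix bs
      show "?R (us @ scale c a # vs) (coset (word_rel scale) (Poly_Mapping.single bs 1))
        = qscale (pair_rel scale) c (?R (us @ a # vs) (coset (word_rel scale) (Poly_Mapping.single bs 1)))"
        unfolding tens_def[symmetric] lift_ptens_tens
        using linear_into_ptens_left unfolding linear_into_def by blast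
    qed
    show ?thesis unfolding linear_into_def using add scale by blast
  qed
  have ot: "(\<lambda>X. otimes scale X Y) = lift (pair_rel scale) UNIV (\<lambda>as. ?R as Y)"
    by (rule ext) (simp add: otimes_def)
  show "qlinear (word_rel scale) UNIV (pair_rel scale) UNIV (\<lambda>X. otimes scale X Y)"
    unfolding ot by (intro qlinear_lift_all_words subspace_pair_rel car lin)
  show "otimes scale (tens scale as) Y = ?R as Y"
    unfolding otimes_def by (intro lift_all_words_tens[OF subspace_pair_rel car lin])
qed

lemma otimes_tens [simp]: "otimes scale (tens scale as) (tens scale bs) = ptens scale as bs"
  by (simp add: otimes_tens_left lift_ptens_tens tens_mem_qcar)

text \<open>The definition of \<open>otimes\<close> treats its arguments asymmetrically. For this
  side \<open>X\<close> is expanded in words; each summand is then an inner lift, linear in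
  \<open>Y\<close>.\<close>

lemma qlinear_otimes_right:
  fixes scale :: "'k::field \<Rightarrow> 'a::ab_group_add \<Rightarrow> 'a"
  assumes X: "X \<in> qcar (word_rel scale) UNIV"
  shows "qlinear (word_rel scale) UNIV (pair_rel scale) UNIV (otimes scale X)"
proof -
  obtain x where x: "X = coset (word_rel scale) x" using X by (rule qcarE)
  let ?R = "\<lambda>as. lift (pair_rel scale) UNIV (ptens scale as)"
  have "qlinear (word_rel scale) UNIV (pair_rel scale) UNIV (\<lambda>Y. qsum (pair_rel scale)
      (\<lambda>as. qscale (pair_rel scale) (Poly_Mapping.lookup x as) (?R as Y)) (Poly_Mapping.keys x))"
    by (intro qlinear_qsum_fun subspace_pair_rel qlinear_otimes_tens)
  then show ?thesis
  proof (rule qlinear_cong)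
    fix Y assume Y: "Y \<in> qcar (word_rel scale) UNIV"
    show "qsum (pair_rel scale) (\<lambda>as. qscale (pair_rel scale) (Poly_Mapping.lookup x as) (?R as Y))
        (Poly_Mapping.keys x) = otimes scale X Y"
      unfolding x using qlinear_expand[OF subspace_pair_rel qlinear_otimes_left[OF Y], of x]
      by (simp add: tens_def[symmetric] otimes_tens_left[OF Y])
  qed
qed

lemma
  shows qlinear_conc: "qlinear (pair_rel scale) UNIV (word_rel scale) UNIV (conc scale)"
    and conc_ptens [simp]: "conc scale (ptens scale as bs) = tens scale (as @ bs)"
proof -
  have lin: "linear_into scale (word_rel scale) (\<lambda>a. tens scale (us @ a # vs @ ws))"
    "linear_into scale (word_rel scale) (\<lambda>a. tens scale (ws @ us @ a # vs))" for us vs ws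
    using linear_into_tens[of scale us "vs @ ws"] linear_into_tens[of scale "ws @ us" vs]
    by simp_all
  show "qlinear (pair_rel scale) UNIV (word_rel scale) UNIV (conc scale)"
    unfolding conc_def by (rule qlinear_lift_pairs) (auto intro: lin tens_mem_qcar)
  have "conc scale (ptens scale as bs) = (case (as, bs) of (as, bs) \<Rightarrow> tens scale (as @ bs))"
    unfolding conc_def by (rule lift_pairs_ptens[of _ _ _ UNIV]) (auto intro: lin tens_mem_qcar)
  then show "conc scale (ptens scale as bs) = tens scale (as @ bs)" by simp
qed

text \<open>The product of the tensor algebra. It allows a tensor to be composed of consecutive
  factors that are not pure, such as the image of two letters under \<open>\<sigma>\<close>.\<close>

definition tcat :: "('k::field \<Rightarrow> 'a::ab_group_add \<Rightarrow> 'a) \<Rightarrow> ('a list \<Rightarrow>\<^sub>0 'k) set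
    \<Rightarrow> ('a list \<Rightarrow>\<^sub>0 'k) set \<Rightarrow> ('a list \<Rightarrow>\<^sub>0 'k) set" where
  "tcat scale X Y = conc scale (otimes scale X Y)"

lemma tcat_tens [simp]: "tcat scale (tens scale as) (tens scale bs) = tens scale (as @ bs)"
  by (simp add: tcat_def)

lemma qlinear_tcat:
  assumes "Y \<in> qcar (word_rel scale) UNIV"
  shows "qlinear (word_rel scale) UNIV (word_rel scale) UNIV (\<lambda>X. tcat scale X Y)"
    and "qlinear (word_rel scale) UNIV (word_rel scale) UNIV (tcat scale Y)"
  unfolding tcat_def using assms
  by (auto intro: qlinear_compose[OF _ qlinear_conc] qlinear_otimes_left qlinear_otimes_right)

lemma tcat_tens_mem:
  assumes "Y \<in> tpow scale n"
  shows "tcat scale (tens scale as) Y \<in> tpow scale (length as + n)"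
proof -
  have "tens scale as \<in> qcar (word_rel scale) UNIV" by (simp add: tens_mem_qcar)
  note Q = qlinear_weaken[OF qlinear_tcat(2)[OF this], of "words n" UNIV]
  have "tlinear scale n (length as + n) (tcat scale (tens scale as))"
    by (rule qlinear_restrict[OF subspace_word_rel subspace_word_rel Q])
      (simp_all add: tens_def[symmetric] tens_mem_qcar)
  then show ?thesis using assms by (rule tlinear_mem)
qed

lemma tlinear_tcat_left:
  assumes "Y \<in> tpow scale n"
  shows "tlinear scale m (m + n) (\<lambda>X. tcat scale X Y)"
proof -
  note Q = qlinear_weaken[OF qlinear_tcat(1)[OF tpow_qcar_UNIV[OF assms]], of "words m" UNIV]
  show ?thesis
    by (rule qlinear_restrict[OF subspace_word_rel subspace_word_rel Q])
      (use tcat_tens_mem[OF assms] in \<open>auto simp: tens_def[symmetric] tpow_eq_qcar[symmetric]\<close>)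
qed

lemma tcat_mem:
  "X \<in> tpow scale m \<Longrightarrow> Y \<in> tpow scale n \<Longrightarrow> tcat scale X Y \<in> tpow scale (m + n)"
  by (rule tlinear_mem[OF tlinear_tcat_left])

lemma tlinear_tcat_right:
  assumes "X \<in> tpow scale m"
  shows "tlinear scale n (m + n) (tcat scale X)"
proof -
  note Q = qlinear_weaken[OF qlinear_tcat(2)[OF tpow_qcar_UNIV[OF assms]], of "words n" UNIV]
  show ?thesis
    by (rule qlinear_restrict[OF subspace_word_rel subspace_word_rel Q])
      (use tcat_mem[OF assms] in \<open>auto simp: tens_def[symmetric] tpow_eq_qcar[symmetric]\<close>)
qed

text \<open>Trilinearity, used one argument at a time: pure tensors are replaced by arbitrary ones
  in the third, then in the second, then in the first factor.\<close>

lemma tcat_assoc: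
  assumes X: "X \<in> tpow scale l" and Y: "Y \<in> tpow scale m" and Z: "Z \<in> tpow scale n"
  shows "tcat scale (tcat scale X Y) Z = tcat scale X (tcat scale Y Z)"
proof -
  have 1: "tcat scale (tens scale (as @ bs)) Z = tcat scale (tens scale as) (tcat scale (tens scale bs) Z)"
    if "length as = l" "length bs = m" for as bs
    using that
    by (intro tlinear_eqI[OF tlinear_tcat_right[of _ _ "l + m"]
          qlinear_compose[OF tlinear_tcat_right[of _ _ m] tlinear_tcat_right[of _ _ l]] _ _ Z]) auto
  have 2: "tcat scale (tcat scale (tens scale as) Y) Z = tcat scale (tens scale as) (tcat scale Y Z)"
    if "length as = l" for as
    using that 1
    by (intro tlinear_eqI[OF qlinear_compose[OF tlinear_tcat_right[of _ _ l] tlinear_tcat_left[OF Z]]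
          qlinear_compose[OF tlinear_tcat_left[OF Z] tlinear_tcat_right[of _ _ l]] _ _ Y]) auto
  show ?thesis
    using 2
    by (intro tlinear_eqI[OF qlinear_compose[OF tlinear_tcat_left[OF Y] tlinear_tcat_left[OF Z]]
          tlinear_tcat_left[OF tcat_mem[OF Y Z]] _ _ X]) auto
qed

subsection \<open>Tensor products of maps\<close>

lemma
  assumes f: "tlinear scale p m f" and g: "tlinear scale q n g"
  shows tlinear_tmap: "tlinear scale (p + q) (m + n) (tmap scale p q f g)"
    and tmap_tens: "length as = p + q \<Longrightarrow> tmap scale p q f g (tens scale as)
      = tcat scale (f (tens scale (take p as))) (g (tens scale (drop p as)))"
proof -
  let ?F = "\<lambda>as. tcat scale (f (tens scale (take p as))) (g (tens scale (drop p as)))"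
  have car: "?F as \<in> qcar (word_rel scale) (words (m + n))" if "length as = p + q" for as
    using that f g unfolding tpow_eq_qcar[symmetric]
    by (intro tcat_mem tlinear_mem[OF f] tlinear_mem[OF g]) auto
  \<comment> \<open>The slot lies in the part given to \<open>f\<close> or in the part given to
    \<open>g\<close>; the other factor then does not depend on \<open>a\<close>, and linearity of
    \<open>tcat\<close> in one argument suffices.\<close>
  have lin: "linear_into scale (word_rel scale) (\<lambda>a. ?F (us @ a # vs))"
    if len: "length us + Suc (length vs) = p + q" for us vs
  proof (cases "length us < p")
    case True
    let ?ws = "drop (p - Suc (length us)) vs" and ?vs = "take (p - Suc (length us)) vs"
    have eq: "take p (us @ a # vs) = us @ a # ?vs" "drop p (us @ a # vs) = ?ws" for a
      using True by (auto simp: take_Cons' drop_Cons')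
    have g': "g (tens scale ?ws) \<in> tpow scale n" using True len by (intro tlinear_mem[OF g]) simp
    show ?thesis unfolding eq
      by (rule linear_into_compose[OF subspace_word_rel subspace_word_rel linear_into_tens
            qlinear_compose[OF f tlinear_tcat_left[OF g']]])
        (use True len in \<open>auto intro: tens_mem_qcar\<close>)
  next
    case False
    let ?ws = "take p us" and ?us = "drop p us"
    have eq: "take p (us @ a # vs) = ?ws" "drop p (us @ a # vs) = ?us @ a # vs" for a
      using False by auto
    have f': "f (tens scale ?ws) \<in> tpow scale m" using False len by (intro tlinear_mem[OF f]) simp
    show ?thesis unfolding eq
      by (rule linear_into_compose[OF subspace_word_rel subspace_word_rel linear_into_tens
            qlinear_compose[OF g tlinear_tcat_right[OF f']]])
        (use False len in \<open>auto intro: tens_mem_qcar\<close>)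
  qed
  have eq: "tmap scale p q f g = lift (word_rel scale) (words (p + q)) ?F"
    by (simp add: tmap_def tcat_def)
  show "tlinear scale (p + q) (m + n) (tmap scale p q f g)"
    unfolding eq by (rule qlinear_lift_words[OF subspace_word_rel car lin])
  show "length as = p + q \<Longrightarrow> tmap scale p q f g (tens scale as) = ?F as"
    unfolding eq by (rule lift_words_tens[OF subspace_word_rel car lin])
qed

text \<open>The formula that defines \<open>tmap\<close> on words persists for factors that are not
  pure, by linearity in each of them.\<close>

lemma tmap_tcat:
  assumes f: "tlinear scale p m f" and g: "tlinear scale q n g"
    and X: "X \<in> tpow scale p" and Y: "Y \<in> tpow scale q"
  shows "tmap scale p q f g (tcat scale X Y) = tcat scale (f X) (g Y)"
proof -
  note T = tlinear_tmap[OF f g]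
  have 1: "tmap scale p q f g (tcat scale (tens scale as) Y) = tcat scale (f (tens scale as)) (g Y)"
    if "length as = p" for as
  proof -
    have as: "tens scale as \<in> tpow scale p" using that by simp
    show ?thesis
      by (rule tlinear_eqI[OF qlinear_compose[OF tlinear_tcat_right[OF as] T]
          qlinear_compose[OF g tlinear_tcat_right[OF tlinear_mem[OF f as]]] subspace_word_rel _ Y])
        (use that in \<open>simp add: tmap_tens[OF f g]\<close>)
  qed
  show ?thesis
    by (rule tlinear_eqI[OF qlinear_compose[OF tlinear_tcat_left[OF Y] T]
          qlinear_compose[OF f tlinear_tcat_left[OF tlinear_mem[OF g Y]]] subspace_word_rel 1 X])
qed

lemma
  assumes \<sigma>: "tlinear scale 2 2 \<sigma>" and i: "0 < i" "i < n"
  shows tlinear_sigma_at: "tlinear scale n n (sigma_at scale \<sigma> n i)"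
    and sigma_at_tcat: "U \<in> tpow scale (i - 1) \<Longrightarrow> X \<in> tpow scale 2 \<Longrightarrow> V \<in> tpow scale (n - i - 1) \<Longrightarrow>
      sigma_at scale \<sigma> n i (tcat scale U (tcat scale X V)) = tcat scale U (tcat scale (\<sigma> X) V)"
proof -
  note T = tlinear_tmap[OF \<sigma> tlinear_id[of scale "n - i - 1"]]
  \<comment> \<open>By these equations the degrees of the nested \<open>tmap\<close> fit together.
    They rely on \<open>0 < i\<close> and \<open>i < n\<close> because subtraction is
    truncated.\<close>
  have e: "2 + (n - i - 1) = n - i + 1" "(i - 1) + (n - i + 1) = n" using i by auto
  note T' = T[unfolded e(1)]
  show "tlinear scale n n (sigma_at scale \<sigma> n i)"
    unfolding sigma_at_def using tlinear_tmap[OF tlinear_id T'] e by metis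
  show "sigma_at scale \<sigma> n i (tcat scale U (tcat scale X V)) = tcat scale U (tcat scale (\<sigma> X) V)"
    if "U \<in> tpow scale (i - 1)" "X \<in> tpow scale 2" "V \<in> tpow scale (n - i - 1)"
  proof -
    have "tcat scale X V \<in> tpow scale (n - i + 1)" using tcat_mem[OF that(2,3)] e by simp
    then show ?thesis
      unfolding sigma_at_def
      by (simp only: tmap_tcat[OF tlinear_id T' that(1)] tmap_tcat[OF \<sigma> tlinear_id that(2,3)] id_apply)
  qed
qed

text \<open>The word is cut into \<open>us\<close>, \<open>x\<close>, \<open>ms\<close>,
  \<open>y\<close>, \<open>vs\<close>, with \<open>x\<close> at places \<open>i\<close>,
  \<open>i + 1\<close> and \<open>y\<close> at places \<open>j\<close>, \<open>j + 1\<close>. The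
  two maps then act on different tensor factors; \<open>ms\<close> may be empty.\<close>

lemma sigma_at_commute:
  fixes scale :: "'k::field \<Rightarrow> 'a::ab_group_add \<Rightarrow> 'a"
  assumes \<sigma>: "tlinear scale 2 2 \<sigma>" and i: "0 < i" "Suc i < j" "j < n" and Z: "Z \<in> tpow scale n"
  shows "sigma_at scale \<sigma> n i (sigma_at scale \<sigma> n j Z) = sigma_at scale \<sigma> n j (sigma_at scale \<sigma> n i Z)"
proof -
  have Q: "tlinear scale n n (sigma_at scale \<sigma> n i)" "tlinear scale n n (sigma_at scale \<sigma> n j)"
    using i by (auto intro: tlinear_sigma_at[OF \<sigma>])
  show ?thesis
  proof (rule tlinear_eqI[OF qlinear_compose[OF Q(2,1)] qlinear_compose[OF Q] subspace_word_rel _ Z])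
    fix as :: "'a list" assume len: "length as = n"
    define us where "us = take (i - 1) as"
    define x where "x = take 2 (drop (i - 1) as)"
    define ms where "ms = take (j - i - 2) (drop (i + 1) as)"
    define y where "y = take 2 (drop (j - 1) as)"
    define vs where "vs = drop (j + 1) as"
    have as: "as = us @ x @ ms @ y @ vs"
    proof -
      have "drop (j - 1) as = y @ vs"
      proof -
        have "drop 2 (drop (j - 1) as) = vs" using i by (simp add: vs_def)
        then show ?thesis unfolding y_def by (metis append_take_drop_id)
      qed
      moreover have "drop (i + 1) as = ms @ drop (j - 1) as"
      proof -
        have "j - i - 2 + (i + 1) = j - 1" using i by linarith
        then have "drop (j - i - 2) (drop (i + 1) as) = drop (j - 1) as" by (simp only: drop_drop)
        then show ?thesis unfolding ms_def by (metis append_take_drop_id)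
      qed
      moreover have "drop (i - 1) as = x @ drop (i + 1) as"
      proof -
        have "drop 2 (drop (i - 1) as) = drop (i + 1) as" using i by simp
        then show ?thesis unfolding x_def by (metis append_take_drop_id)
      qed
      ultimately show ?thesis unfolding us_def by (metis append_take_drop_id)
    qed
    have us: "tens scale us \<in> tpow scale (i - 1)" using i len by (simp add: us_def)
    have ms: "tens scale ms \<in> tpow scale (j - i - 2)" using i len by (simp add: ms_def)
    have vs: "tens scale vs \<in> tpow scale (n - j - 1)" using i len by (simp add: vs_def)
    have x: "tens scale x \<in> tpow scale 2" using i len by (simp add: x_def)
    have y: "tens scale y \<in> tpow scale 2" using i len by (simp add: y_def)
    let ?t = "\<lambda>X Y. tcat scale (tens scale us) (tcat scale X (tcat scale (tens scale ms) (tcat scale Y (tens scale vs))))"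
    have si: "sigma_at scale \<sigma> n i (?t X Y) = ?t (\<sigma> X) Y"
      if "X \<in> tpow scale 2" "Y \<in> tpow scale 2" for X Y
    proof -
      have "tcat scale (tens scale ms) (tcat scale Y (tens scale vs)) \<in> tpow scale (n - i - 1)"
      proof -
        have "j - i - 2 + (2 + (n - j - 1)) = n - i - 1" using i by linarith
        then show ?thesis using tcat_mem[OF ms tcat_mem[OF that(2) vs]] by (simp only:)
      qed
      then show ?thesis using us that i by (intro sigma_at_tcat[OF \<sigma>]) auto
    qed
    have sj: "sigma_at scale \<sigma> n j (?t X Y) = ?t X (\<sigma> Y)"
      if "X \<in> tpow scale 2" "Y \<in> tpow scale 2" for X Y
    proof -
      let ?U = "tcat scale (tens scale us) (tcat scale X (tens scale ms))"
      have U: "?U \<in> tpow scale (j - 1)"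
      proof -
        have "i - 1 + (2 + (j - i - 2)) = j - 1" using i by linarith
        then show ?thesis using tcat_mem[OF us tcat_mem[OF that(1) ms]] by (simp only:)
      qed
      \<comment> \<open>Reassociation makes everything to the left of \<open>Z\<close> a single
        factor, which is the form required by \<open>sigma_at_tcat\<close>.\<close>
      have eq: "?t X Z = tcat scale ?U (tcat scale Z (tens scale vs))" if Z: "Z \<in> tpow scale 2" for Z
        using tcat_assoc[OF us tcat_mem[OF \<open>X \<in> _\<close> ms] tcat_mem[OF Z vs]]
          tcat_assoc[OF \<open>X \<in> _\<close> ms tcat_mem[OF Z vs]] by simp
      show ?thesis
        unfolding eq[OF that(2)] eq[OF tlinear_mem[OF \<sigma> that(2)]]
        using i U that vs by (intro sigma_at_tcat[OF \<sigma>]) auto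
    qed
    have t: "tens scale as = ?t (tens scale x) (tens scale y)" by (simp add: as)
    show "sigma_at scale \<sigma> n i (sigma_at scale \<sigma> n j (tens scale as))
        = sigma_at scale \<sigma> n j (sigma_at scale \<sigma> n i (tens scale as))"
      unfolding t using x y by (simp only: si sj tlinear_mem[OF \<sigma>])
  qed
qed


subsection \<open>Products\<close>

lemma linear_into_linear:
  "linear_into scale N g \<Longrightarrow> Vector_Spaces.linear scale scale u \<Longrightarrow>
    linear_into scale N (\<lambda>a. g (u a))"
  by (simp add: linear_into_def Vector_Spaces.linear_iff)

fun pair_products :: "('a \<Rightarrow> 'a \<Rightarrow> 'a) \<Rightarrow> 'a list \<Rightarrow> 'a list" where
  "pair_products mul (a # b # as) = mul a b # pair_products mul as"
| "pair_products mul as = []"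

context unital_algebra
begin

lemma
  shows tlinear_mul_map: "tlinear scale 2 1 (mul_map scale mul)"
    and mul_map_tens: "mul_map scale mul (tens scale [a, b]) = tens scale [mul a b]"
proof -
  have lin: "linear_into scale (word_rel scale)
      (\<lambda>a. tens scale [mul ((us @ a # vs) ! 0) ((us @ a # vs) ! 1)])"
    if "length us + Suc (length vs) = 2" for us vs
  proof -
    note l = linear_into_linear[OF linear_into_tens[of scale "[]" "[]", simplified]]
    consider c where "us = []" "vs = [c]" | c where "us = [c]" "vs = []"
      using \<open>length us + Suc (length vs) = 2\<close>
      by (cases us; cases vs; cases "tl vs"; cases "tl us"; fastforce)
    then show ?thesis
      by cases (use l[OF mul_linear_left] l[OF mul_linear_right] in simp_all)
  qed
  show "tlinear scale 2 1 (mul_map scale mul)"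
    unfolding mul_map_def
    by (rule qlinear_lift_words[OF subspace_word_rel _ lin]) (auto intro: tens_mem_qcar)
  have "mul_map scale mul (tens scale [a, b]) = tens scale [mul ([a, b] ! 0) ([a, b] ! 1)]"
    unfolding mul_map_def
    by (rule lift_words_tens[OF subspace_word_rel _ lin, where E = UNIV]) (auto intro: tens_mem_qcar)
  then show "mul_map scale mul (tens scale [a, b]) = tens scale [mul a b]" by simp
qed

lemma tlinear_mul_pow: "tlinear scale (2 * n) n (mul_pow scale mul n)"
proof (induction n)
  case (Suc n)
  then show ?case using tlinear_tmap[OF tlinear_mul_map Suc] by simp
qed (use tlinear_id[of scale 0] in \<open>simp add: id_def\<close>)

lemma mul_pow_tens:
  "length as = 2 * n \<Longrightarrow> mul_pow scale mul n (tens scale as) = tens scale (pair_products mul as)"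
proof (induction n arbitrary: as)
  case (Suc n)
  then obtain a b bs where as: "as = a # b # bs" "length bs = 2 * n"
    by (cases as; cases "tl as") auto
  then show ?case
    using tmap_tens[OF tlinear_mul_map tlinear_mul_pow, of as n] Suc.IH[of bs]
    by (simp add: mul_map_tens)
qed simp

end

subsection \<open>Insertion of units\<close>

text \<open>A pattern records where units are inserted (\<open>None\<close>) and labels the other positions.\<close>

definition labels :: "'b option list \<Rightarrow> 'b list" where
  "labels L = map the (filter (\<lambda>l. l \<noteq> None) L)"

lemma labels_simps [simp]:
  "labels [] = []" "labels (None # L) = labels L" "labels (Some b # L) = b # labels L"
  "labels (L @ L') = labels L @ labels L'"
  by (simp_all add: labels_def)

text \<open>Words are meant to have as many letters as the pattern has labels. The last equation is
  a default that keeps \<open>length_fill\<close> free of conditions.\<close>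

fun fill :: "'a \<Rightarrow> 'b option list \<Rightarrow> 'a list \<Rightarrow> 'a list" where
  "fill one [] as = []"
| "fill one (None # L) as = one # fill one L as"
| "fill one (Some b # L) (a # as) = a # fill one L as"
| "fill one (Some b # L) [] = one # fill one L []"

lemma length_fill [simp]: "length (fill one L as) = length L"
  by (induction one L as rule: fill.induct) auto

lemma fill_append:
  "length as = length (labels L) \<Longrightarrow> fill one (L @ L') (as @ bs) = fill one L as @ fill one L' bs"
  by (induction one L as rule: fill.induct) auto

text \<open>Neither \<open>us'\<close> nor \<open>vs'\<close> depends on \<open>a\<close>, so a slot
  of the argument becomes a slot of the filled word. Multilinearity of the insertion of units
  follows.\<close>

lemma fill_slot:
  "length us + Suc (length vs) = length (labels L) \<Longrightarrow>
    \<exists>us' vs'. \<forall>a. fill one L (us @ a # vs) = us' @ a # vs'"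
proof (induction L arbitrary: us)
  case (Cons l L)
  show ?case
  proof (cases l)
    case None
    then obtain us' vs' where "\<forall>a. fill one L (us @ a # vs) = us' @ a # vs'"
      using Cons by fastforce
    then have "\<forall>a. fill one (l # L) (us @ a # vs) = (one # us') @ a # vs'" using None by simp
    then show ?thesis by blast
  next
    case (Some b)
    show ?thesis
    proof (cases us)
      case Nil
      then have "\<forall>a. fill one (l # L) (us @ a # vs) = [] @ a # fill one L vs" using Some by simp
      then show ?thesis by blast
    next
      case (Cons u us1)
      then obtain us' vs' where "\<forall>a. fill one L (us1 @ a # vs) = us' @ a # vs'"
        using Cons.IH[of us1] Cons.prems Some by fastforce
      then have "\<forall>a. fill one (l # L) (us @ a # vs) = (u # us') @ a # vs'"
        using Some Cons by simp
      then show ?thesis by blast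
    qed
  qed
qed simp

text \<open>The linear extension of \<open>fill\<close>. A map of tensors is required because the
  image of two letters under \<open>\<sigma>\<close> is in general not a word.\<close>

definition insert_ones :: "('k::field \<Rightarrow> 'a::ab_group_add \<Rightarrow> 'a) \<Rightarrow> 'a \<Rightarrow> 'b option list
    \<Rightarrow> ('a list \<Rightarrow>\<^sub>0 'k) set \<Rightarrow> ('a list \<Rightarrow>\<^sub>0 'k) set" where
  "insert_ones scale one L =
     lift (word_rel scale) (words (length (labels L))) (\<lambda>as. tens scale (fill one L as))"

lemma
  shows tlinear_insert_ones:
      "tlinear scale (length (labels L)) (length L) (insert_ones scale one L)"
    and insert_ones_tens: "length as = length (labels L) \<Longrightarrow>
      insert_ones scale one L (tens scale as) = tens scale (fill one L as)"
proof -
  have lin: "linear_into scale (word_rel scale) (\<lambda>a. tens scale (fill one L (us @ a # vs)))"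
    if slot: "length us + Suc (length vs) = length (labels L)" for us vs
  proof -
    obtain us' vs' where "\<forall>a. fill one L (us @ a # vs) = us' @ a # vs'" using fill_slot[OF slot] by blast
    then show ?thesis using linear_into_tens[of scale us' vs'] by simp
  qed
  show "tlinear scale (length (labels L)) (length L) (insert_ones scale one L)"
    unfolding insert_ones_def
    by (rule qlinear_lift_words[OF subspace_word_rel _ lin]) (auto intro: tens_mem_qcar)
  show "insert_ones scale one L (tens scale as) = tens scale (fill one L as)"
    if "length as = length (labels L)"
    unfolding insert_ones_def
    by (rule lift_words_tens[OF subspace_word_rel _ lin that, where E = UNIV])
      (auto intro: tens_mem_qcar)
qed

lemma insert_ones_append:
  assumes X: "X \<in> tpow scale (length (labels L))" and Y: "Y \<in> tpow scale (length (labels L'))"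
  shows "insert_ones scale one (L @ L') (tcat scale X Y)
    = tcat scale (insert_ones scale one L X) (insert_ones scale one L' Y)"
proof -
  let ?I = "insert_ones scale one"
  have T: "tlinear scale (length (labels L) + length (labels L')) (length (L @ L')) (?I (L @ L'))"
    using tlinear_insert_ones[of scale "L @ L'" one] by simp
  have 1: "?I (L @ L') (tcat scale (tens scale as) Y) = tcat scale (?I L (tens scale as)) (?I L' Y)"
    if "length as = length (labels L)" for as
  proof -
    have as: "tens scale as \<in> tpow scale (length (labels L))" using that by simp
    show ?thesis
      by (rule tlinear_eqI[OF qlinear_compose[OF tlinear_tcat_right[OF as] T]
          qlinear_compose[OF tlinear_insert_ones
            tlinear_tcat_right[OF tlinear_mem[OF tlinear_insert_ones as]]] subspace_word_rel _ Y])
        (use that in \<open>simp add: insert_ones_tens fill_append\<close>)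
  qed
  show ?thesis
    by (rule tlinear_eqI[OF qlinear_compose[OF tlinear_tcat_left[OF Y] T]
          qlinear_compose[OF tlinear_insert_ones
            tlinear_tcat_left[OF tlinear_mem[OF tlinear_insert_ones Y]]] subspace_word_rel 1 X])
qed

lemma split_word:
  assumes "length as = k + l + m"
  obtains us xs vs where "as = us @ xs @ vs" "length us = k" "length xs = l" "length vs = m"
proof
  show "as = take k as @ take l (drop k as) @ drop (k + l) as"
    by (metis append_take_drop_id drop_drop add.commute)
qed (use assms in auto)

section \<open>The braiding on tensors with inserted units\<close>

context
  fixes scale :: "'k::field \<Rightarrow> 'a::ab_group_add \<Rightarrow> 'a" and one :: 'a
    and \<sigma> :: "('a list \<Rightarrow>\<^sub>0 'k) set \<Rightarrow> ('a list \<Rightarrow>\<^sub>0 'k) set"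
  assumes \<sigma>: "tlinear scale 2 2 \<sigma>"
begin

lemma sigma_at_tens:
  assumes "length xs = 2" "length us + length xs + length vs = n"
  shows "sigma_at scale \<sigma> n (Suc (length us)) (tens scale (us @ xs @ vs))
    = tcat scale (tens scale us) (tcat scale (\<sigma> (tens scale xs)) (tens scale vs))"
  using sigma_at_tcat[OF \<sigma>, of "Suc (length us)" n "tens scale us" "tens scale xs" "tens scale vs"] assms
  by simp

text \<open>The two entries concerned hold at most one letter, so \<open>\<sigma>\<close> is
  evaluated by the unit axioms: only the pattern changes, while \<open>X\<close> is left alone. For
  two units the pattern stays the same.\<close>

lemma sigma_at_insert_ones_unit:
  assumes unit: "\<And>a. \<sigma> (tens scale [a, one]) = tens scale [one, a]"
      "\<And>a. \<sigma> (tens scale [one, a]) = tens scale [a, one]"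
    and uv: "u = None \<or> v = None" and n: "n = length P + 2 + length Q"
    and X: "X \<in> tpow scale (length (labels (P @ [u, v] @ Q)))"
  shows "sigma_at scale \<sigma> n (Suc (length P)) (insert_ones scale one (P @ [u, v] @ Q) X)
    = insert_ones scale one (P @ [v, u] @ Q) X"
proof -
  have same: "length (labels [v, u]) = length (labels [u, v])" by (cases u; cases v) auto
  have T1: "tlinear scale (length (labels (P @ [u, v] @ Q))) n (insert_ones scale one (P @ [u, v] @ Q))"
    using tlinear_insert_ones[of scale "P @ [u, v] @ Q" one] n by simp
  have T2: "tlinear scale (length (labels (P @ [u, v] @ Q))) n (insert_ones scale one (P @ [v, u] @ Q))"
  proof -
    have "length (labels (P @ [u, v] @ Q)) = length (labels (P @ [v, u] @ Q))"
      by (cases u; cases v) simp_all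
    then show ?thesis using tlinear_insert_ones[of scale "P @ [v, u] @ Q" one] n by simp
  qed
  have T3: "tlinear scale n n (sigma_at scale \<sigma> n (Suc (length P)))"
    using n by (intro tlinear_sigma_at[OF \<sigma>]) auto
  show ?thesis
  proof (rule tlinear_eqI[OF qlinear_compose[OF T1 T3] T2 subspace_word_rel _ X])
    fix as :: "'a list" assume len: "length as = length (labels (P @ [u, v] @ Q))"
    then have "length as = length (labels P) + length (labels [u, v]) + length (labels Q)"
      by (simp only: labels_simps(4) length_append)
    then obtain us xs vs where as: "as = us @ xs @ vs" "length us = length (labels P)"
      "length xs = length (labels [u, v])" "length vs = length (labels Q)"
      by (rule split_word)
    have swap: "\<sigma> (tens scale (fill one [u, v] xs)) = tens scale (fill one [v, u] xs)"
      using uv as(3) unit by (cases u; cases v; cases xs) auto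
    have "insert_ones scale one (P @ [u, v] @ Q) (tens scale as)
        = tens scale (fill one P us @ fill one [u, v] xs @ fill one Q vs)"
      using len by (simp only: insert_ones_tens as(1) fill_append as(2,3))
    moreover have "insert_ones scale one (P @ [v, u] @ Q) (tens scale as)
        = tens scale (fill one P us @ fill one [v, u] xs @ fill one Q vs)"
      using as same by (simp only: insert_ones_tens as(1) fill_append length_append labels_simps(4))
    moreover have "sigma_at scale \<sigma> n (Suc (length P))
        (tens scale (fill one P us @ fill one [u, v] xs @ fill one Q vs))
      = tens scale (fill one P us @ fill one [v, u] xs @ fill one Q vs)"
      using sigma_at_tens[of "fill one [u, v] xs" "fill one P us" "fill one Q vs" n] swap n
      by simp
    ultimately show "sigma_at scale \<sigma> n (Suc (length P)) (insert_ones scale one (P @ [u, v] @ Q) (tens scale as))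
      = insert_ones scale one (P @ [v, u] @ Q) (tens scale as)" by (simp only:)
  qed
qed

text \<open>Here \<open>\<sigma>\<close> acts on the letters themselves; forgetting the units to the
  left shifts the index from \<open>length P\<close> to \<open>length (labels P)\<close>. The result
  on the two letters need not be pure, so insertion is evaluated factor by factor with
  \<open>insert_ones_append\<close>.\<close>

lemma sigma_at_insert_ones_labels:
  assumes n: "n = length P + 2 + length Q" and k: "k = length (labels P) + 2 + length (labels Q)"
    and X: "X \<in> tpow scale k"
  shows "sigma_at scale \<sigma> n (Suc (length P)) (insert_ones scale one (P @ [Some b, Some c] @ Q) X)
    = insert_ones scale one (P @ [Some c, Some b] @ Q) (sigma_at scale \<sigma> k (Suc (length (labels P))) X)"
proof -
  let ?I = "insert_ones scale one"
  have T1: "tlinear scale k n (?I (P @ [Some b, Some c] @ Q))" for b c :: 'b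
    using tlinear_insert_ones[of scale "P @ [Some b, Some c] @ Q" one] n k by simp
  have T3: "tlinear scale n n (sigma_at scale \<sigma> n (Suc (length P)))"
    using n by (intro tlinear_sigma_at[OF \<sigma>]) auto
  have T4: "tlinear scale k k (sigma_at scale \<sigma> k (Suc (length (labels P))))"
    using k by (intro tlinear_sigma_at[OF \<sigma>]) auto
  show ?thesis
  proof (rule tlinear_eqI[OF qlinear_compose[OF T1 T3] qlinear_compose[OF T4 T1] subspace_word_rel _ X])
    fix as :: "'a list" assume "length as = k"
    then have "length as = length (labels P) + 2 + length (labels Q)" using k by simp
    then obtain us xs vs where as: "as = us @ xs @ vs" "length us = length (labels P)"
      "length xs = 2" "length vs = length (labels Q)"
      by (rule split_word)
    from as(3) obtain x y where xs: "xs = [x, y]" by (cases xs; cases "tl xs") auto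
    have Y: "\<sigma> (tens scale xs) \<in> tpow scale (length (labels [Some c, Some b]))"
    proof -
      have "length (labels [Some c, Some b]) = 2" by simp
      moreover have "\<sigma> (tens scale xs) \<in> tpow scale 2" using as(3) by (intro tlinear_mem[OF \<sigma>]) simp
      ultimately show ?thesis by (simp only:)
    qed
    \<comment> \<open>A pattern without units inserts nothing, also into tensors that are not
      pure.\<close>
    have id: "?I [Some c, Some b] Z = id Z" if "Z \<in> tpow scale 2" for Z
    proof (rule tlinear_eqI[OF _ tlinear_id subspace_word_rel _ that])
      show "tlinear scale 2 2 (?I [Some c, Some b])"
        using tlinear_insert_ones[of scale "[Some c, Some b]" one] by (simp add: numeral_2_eq_2)
      fix zs :: "'a list" assume "length zs = 2"
      then show "?I [Some c, Some b] (tens scale zs) = id (tens scale zs)"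
        by (cases zs; cases "tl zs") (auto simp: insert_ones_tens)
    qed
    have "?I (P @ [Some b, Some c] @ Q) (tens scale as) = tens scale (fill one P us @ xs @ fill one Q vs)"
      using as xs by (simp add: insert_ones_tens fill_append)
    then have "sigma_at scale \<sigma> n (Suc (length P)) (?I (P @ [Some b, Some c] @ Q) (tens scale as))
      = tcat scale (tens scale (fill one P us)) (tcat scale (\<sigma> (tens scale xs)) (tens scale (fill one Q vs)))"
      using sigma_at_tens[of xs "fill one P us" "fill one Q vs" n] as n by simp
    also have "\<dots> = tcat scale (?I P (tens scale us))
        (tcat scale (?I [Some c, Some b] (\<sigma> (tens scale xs))) (?I Q (tens scale vs)))"
    proof -
      have "\<sigma> (tens scale xs) \<in> tpow scale 2" using as(3) by (intro tlinear_mem[OF \<sigma>]) simp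
      then show ?thesis using as(2,4) by (simp only: insert_ones_tens id id_apply)
    qed
    also have "\<dots> = ?I (P @ [Some c, Some b] @ Q)
        (tcat scale (tens scale us) (tcat scale (\<sigma> (tens scale xs)) (tens scale vs)))"
    proof -
      have V: "tens scale vs \<in> tpow scale (length (labels Q))" using as by simp
      have U: "tens scale us \<in> tpow scale (length (labels P))" using as by simp
      have "tcat scale (\<sigma> (tens scale xs)) (tens scale vs)
          \<in> tpow scale (length (labels ([Some c, Some b] @ Q)))"
        using tcat_mem[OF Y V] by simp
      then show ?thesis by (simp only: insert_ones_append[OF U] insert_ones_append[OF Y V])
    qed
    also have "tcat scale (tens scale us) (tcat scale (\<sigma> (tens scale xs)) (tens scale vs))
        = sigma_at scale \<sigma> k (Suc (length (labels P))) (tens scale as)"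
      using sigma_at_tens[of xs us vs k] as k by simp
    finally show "sigma_at scale \<sigma> n (Suc (length P)) (?I (P @ [Some b, Some c] @ Q) (tens scale as))
      = ?I (P @ [Some c, Some b] @ Q) (sigma_at scale \<sigma> k (Suc (length (labels P))) (tens scale as))" .
  qed
qed

lemma sigma_word_Nil [simp]: "sigma_word scale \<sigma> n [] X = X"
  by (simp add: sigma_word_def)

lemma sigma_word_Cons [simp]:
  "sigma_word scale \<sigma> n (i # is) X = sigma_at scale \<sigma> n i (sigma_word scale \<sigma> n is X)"
  by (simp add: sigma_word_def)

lemma tlinear_sigma_word:
  "set is \<subseteq> {1..<n} \<Longrightarrow> tlinear scale n n (sigma_word scale \<sigma> n is)"
proof (induction "is")
  case Nil
  show ?case using tlinear_id by (rule qlinear_cong) simp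
next
  case (Cons i "is")
  then have "tlinear scale n n (\<lambda>X. sigma_at scale \<sigma> n i (sigma_word scale \<sigma> n is X))"
    by (intro qlinear_compose[OF Cons.IH] tlinear_sigma_at[OF \<sigma>]) auto
  then show ?case by (rule qlinear_cong) simp
qed

end

section \<open>The maps \<open>s'\<close> as insertions along a pattern\<close>

lemma insert_unit_tens:
  fixes scale :: "'k::field \<Rightarrow> 'a::ab_group_add \<Rightarrow> 'a"
  assumes "length as = p"
  shows "insert_unit scale one p i (tens scale as) = tens scale (take i as @ [one] @ drop i as)"
proof -
  have lin: "linear_into scale (word_rel scale)
      (\<lambda>a. tens scale (take i (us @ a # vs) @ [one] @ drop i (us @ a # vs)))" for us vs
  proof (cases "i \<le> length us")
    case True
    then show ?thesis using linear_into_tens[of scale "take i us @ [one] @ drop i us" vs] by simp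
  next
    case False
    then have "take i (us @ a # vs) @ [one] @ drop i (us @ a # vs)
      = us @ a # take (i - Suc (length us)) vs @ [one] @ drop (i - Suc (length us)) vs" for a
      by (auto simp: take_Cons' drop_Cons')
    then show ?thesis by (simp only: linear_into_tens)
  qed
  show ?thesis
    unfolding insert_unit_def
    by (rule lift_words_tens[OF subspace_word_rel _ lin assms, where E = UNIV])
      (auto intro: tens_mem_qcar)
qed

lemma insert_units_tens:
  "length as = p \<Longrightarrow> insert_units scale one p is (tens scale as)
    = tens scale (foldl (\<lambda>as i. take i as @ [one] @ drop i as) as is)"
  by (induction "is" arbitrary: p as) (simp_all add: insert_unit_tens)

lemma length_labels_map:
  "length (labels (map f xs)) = length (filter (\<lambda>x. f x \<noteq> None) xs)"
  by (simp add: labels_def filter_map o_def)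

lemma length_labels_complement:
  assumes "distinct is" "set is \<subseteq> {..<n}"
  shows "length (labels (map (\<lambda>i. if i \<in> set is then None else Some b) [0..<n])) = n - length is"
proof -
  have "length (filter (\<lambda>i. i \<notin> set is) [0..<n]) = card ({i. i \<notin> set is} \<inter> {0..<n})"
    by (simp add: distinct_length_filter)
  also have "{i. i \<notin> set is} \<inter> {0..<n} = {..<n} - set is" by auto
  also have "card \<dots> = n - length is"
    using assms by (simp add: card_Diff_subset distinct_card)
  finally show ?thesis by (simp add: length_labels_map if_distrib[of "\<lambda>x. x \<noteq> None"] cong: if_cong)
qed

lemma fill_replicate: "length as = m \<Longrightarrow> fill one (replicate m (Some b)) as = as"
  by (induction m arbitrary: as) (auto simp: length_Suc_conv)

text \<open>As the indices increase, a later insertion takes place to the right of all earlier units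
  and does not displace them. The final places of the units are therefore the indices themselves.
  The label \<open>b\<close> is arbitrary since \<open>fill\<close> does not look at it.\<close>

lemma foldl_insert_eq_fill:
  assumes "sorted_wrt (<) is" "set is \<subseteq> {..<n}" "length as + length is = n"
  shows "foldl (\<lambda>as i. take i as @ [one] @ drop i as) as is
    = fill one (map (\<lambda>i. if i \<in> set is then None else Some b) [0..<n]) as"
  using assms
proof (induction "is" arbitrary: n rule: rev_induct)
  case Nil
  then have "map (\<lambda>i. if i \<in> set [] then None else Some b) [0..<n] = replicate n (Some b)"
    by (simp add: map_replicate_const)
  then show ?case using Nil by (simp only: foldl_Nil fill_replicate list.size add_0_right)
next
  case (snoc j "is")
  let ?G = "\<lambda>is i. if i \<in> set is then None else Some b"
  have less: "i < j" if "i \<in> set is" for i using snoc.prems that by (auto simp: sorted_wrt_append)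
  have j: "j < n" using snoc.prems by auto
  let ?A = "map (?G is) [0..<j]" and ?r = "n - Suc j"
  have "distinct is" using snoc.prems by (auto simp: sorted_wrt_append strict_sorted_iff)
  then have A: "length (labels ?A) = j - length is" and "length is \<le> j"
    using length_labels_complement[of "is" j b] less card_mono[of "{..<j}" "set is"]
    by (auto simp: distinct_card subset_iff)
  \<comment> \<open>All \<open>length is\<close> earlier units stand to the left of place
    \<open>j\<close>, together with \<open>j - length is\<close> letters.\<close>
  define as1 where "as1 = take (j - length is) as"
  define as2 where "as2 = drop (j - length is) as"
  have as: "as = as1 @ as2" "length as1 = length (labels ?A)" "length as2 = ?r"
    using snoc.prems j A \<open>length is \<le> j\<close> by (auto simp: as1_def as2_def)
  have const: "map (?G is) [j..<m] = replicate (m - j) (Some b)" for m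
    using less by (intro replicate_eqI) (auto dest: less)
  have const': "map (?G (is @ [j])) [Suc j..<n] = replicate ?r (Some b)"
    using less by (intro replicate_eqI) (auto dest: less)
  have "[0..<n - 1] = [0..<j] @ [j..<n - 1]" 
    using j upt_add_eq_append[of 0 j "n - 1 - j"] by simp
  then have 1: "map (?G is) [0..<n - 1] = ?A @ replicate ?r (Some b)"
    using const[of "n - 1"] by simp
  have "[0..<n] = [0..<j] @ [j] @ [Suc j..<n]"
    using j upt_add_eq_append[of 0 j "n - j"] by (simp add: upt_conv_Cons)
  moreover have "map (?G (is @ [j])) [0..<j] = ?A" by auto
  ultimately have 2: "map (?G (is @ [j])) [0..<n] = ?A @ [None] @ replicate ?r (Some b)"
    using const' by simp
  have "foldl (\<lambda>as i. take i as @ [one] @ drop i as) as is = fill one (map (?G is) [0..<n - 1]) as"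
  proof (rule snoc.IH)
    show "set is \<subseteq> {..<n - 1}"
    proof
      fix i assume "i \<in> set is"
      then show "i \<in> {..<n - 1}" using less[of i] j by simp
    qed
  qed (use snoc.prems in \<open>auto simp: sorted_wrt_append\<close>)
  also have "\<dots> = fill one ?A as1 @ as2"
    unfolding 1 as(1) using as by (simp only: fill_append fill_replicate)
  finally have "foldl (\<lambda>as i. take i as @ [one] @ drop i as) as (is @ [j])
      = fill one ?A as1 @ [one] @ as2" by simp
  also have "\<dots> = fill one (map (?G (is @ [j])) [0..<n]) as"
    unfolding 2 as(1) using as by (simp add: fill_append fill_replicate)
  finally show ?case .
qed


section \<open>Reduced words of shuffles\<close>

lemma perm_word_Nil [simp]: "perm_word [] = id"
  by (simp add: perm_word_def)

lemma perm_word_Cons: "perm_word (i # is) = Transposition.transpose i (Suc i) \<circ> perm_word is"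
  by (simp add: perm_word_def)

lemma image_perm_word_Cons [simp]:
  "perm_word (i # is) ` S = Transposition.transpose i (Suc i) ` perm_word is ` S"
  by (simp only: perm_word_Cons image_comp)

lemma perm_word_permutes: "set is \<subseteq> {1..<n} \<Longrightarrow> perm_word is permutes {1..n}"
proof (induction "is")
  case (Cons i "is")
  then show ?case
    unfolding perm_word_Cons by (intro permutes_compose permutes_swap_id) auto
qed (simp add: permutes_id)

lemma mem_image_transpose:
  "x \<in> Transposition.transpose i j ` T \<longleftrightarrow> Transposition.transpose i j x \<in> T"
  by (metis imageE imageI transpose_involutory)

text \<open>
  A shuffle is determined by the image of the first block \<open>S\<close>. In an ascending word every letter
  \<open>i\<close> moves one element of this image from \<open>i\<close> to \<open>i + 1\<close>.
\<close>

fun ascending_word :: "nat set \<Rightarrow> nat list \<Rightarrow> bool" where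
  "ascending_word S [] \<longleftrightarrow> True"
| "ascending_word S (i # is) \<longleftrightarrow>
     ascending_word S is \<and> i \<in> perm_word is ` S \<and> Suc i \<notin> perm_word is ` S"

text \<open>Unless exactly one of \<open>i\<close> and \<open>Suc i\<close> lies in
  \<open>T\<close>, the transposition maps \<open>T\<close> onto itself; otherwise it moves one
  element up or down by one.\<close>

lemma sum_image_transpose:
  fixes T :: "nat set"
  assumes "finite T"
  shows "\<Sum> (Transposition.transpose i (Suc i) ` T) \<le> Suc (\<Sum> T)"
    and "\<Sum> (Transposition.transpose i (Suc i) ` T) = Suc (\<Sum> T) \<longleftrightarrow> i \<in> T \<and> Suc i \<notin> T"
proof -
  let ?t = "Transposition.transpose i (Suc i)" and ?U = "T - {i, Suc i}"
  have U: "?t ` ?U = ?U" "finite ?U" using assms by (auto simp: transpose_image_eq)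
  consider "i \<in> T \<longleftrightarrow> Suc i \<in> T" | "i \<in> T" "Suc i \<notin> T" | "i \<notin> T" "Suc i \<in> T" by blast
  then have "\<Sum> (?t ` T) \<le> Suc (\<Sum> T) \<and> (\<Sum> (?t ` T) = Suc (\<Sum> T) \<longleftrightarrow> i \<in> T \<and> Suc i \<notin> T)"
  proof cases
    case 1
    then show ?thesis by simp
  next
    case 2
    then have T: "T = insert i ?U" by auto
    have "?t ` T = insert (Suc i) ?U" by (subst T) (simp only: image_insert U transpose_apply_first)
    moreover have "\<Sum> T = i + \<Sum> ?U" by (subst T) (use U in simp)
    ultimately show ?thesis using 2 U by simp
  next
    case 3
    then have T: "T = insert (Suc i) ?U" by auto
    have "?t ` T = insert i ?U" by (subst T) (simp only: image_insert U transpose_apply_second)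
    moreover have "\<Sum> T = Suc i + \<Sum> ?U" by (subst T) (use U in simp)
    ultimately show ?thesis using 3 U by simp
  qed
  then show "\<Sum> (?t ` T) \<le> Suc (\<Sum> T)" "\<Sum> (?t ` T) = Suc (\<Sum> T) \<longleftrightarrow> i \<in> T \<and> Suc i \<notin> T"
    by blast+
qed

text \<open>No letter raises the sum by more than one, so equality says that every letter does raise
  it. Being ascending thus depends only on the length of the word and on the image of
  \<open>S\<close>.\<close>

lemma sum_image_perm_word:
  assumes "finite S"
  shows "\<Sum> (perm_word is ` S) \<le> \<Sum> S + length is"
    and "\<Sum> (perm_word is ` S) = \<Sum> S + length is \<longleftrightarrow> ascending_word S is"
proof (induction "is")
  case (Cons i "is")
  let ?T = "perm_word is ` S"
  have T: "finite ?T" using assms by simp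
  have eq: "perm_word (i # is) ` S = Transposition.transpose i (Suc i) ` ?T"
    by simp
  {
    case 1
    show ?case unfolding eq using sum_image_transpose(1)[OF T, of i] Cons.IH(1) by simp
  next
    case 2
    show ?case unfolding eq
      using sum_image_transpose[OF T, of i] Cons.IH by auto
  }
qed simp_all

text \<open>On each block a shuffle lists the image of the block in increasing order, and the image
  of the second block is the complement of that of the first.\<close>

lemma shuffle_perms_eqI:
  assumes w: "w \<in> shuffle_perms p n" "w' \<in> shuffle_perms p n" and "p \<le> n"
    and im: "w ` {1..p} = w' ` {1..p}"
  shows "w = w'"
proof
  have eq: "w x = w' x" if "strict_mono_on {a..b} w" "strict_mono_on {a..b} w'"
    "w ` {a..b} = w' ` {a..b}" "x \<in> {a..b}" for a b x
  proof -
    have sorted: "sorted_wrt (<) (map v [a..<Suc b])" if "strict_mono_on {a..b} v" for v :: "nat \<Rightarrow> nat"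
      unfolding sorted_wrt_map
      by (rule sorted_wrt_mono_rel[OF _ sorted_wrt_upt]) (use that in \<open>auto simp: strict_mono_on_def\<close>)
    have "map w [a..<Suc b] = map w' [a..<Suc b]"
      using that by (intro strict_sorted_equal sorted) (simp_all add: atLeastLessThanSuc_atLeastAtMost del: upt_Suc)
    then have "\<forall>x\<in>set [a..<Suc b]. w x = w' x" by (simp only: map_eq_conv)
    then show ?thesis using that(4) by (simp del: upt_Suc)
  qed
  have compl: "v ` {p + 1..n} = {1..n} - v ` {1..p}" if "v \<in> shuffle_perms p n" for v
  proof -
    have v: "inj v" "v ` {1..n} = {1..n}"
      using that permutes_inj permutes_image unfolding shuffle_perms_def by blast+
    have "{p + 1..n} = {1..n} - {1..p}" using \<open>p \<le> n\<close> by auto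
    then show ?thesis using image_set_diff[OF v(1), of "{1..n}" "{1..p}"] v(2) by simp
  qed
  fix x
  consider "x \<in> {1..p}" | "x \<in> {p + 1..n}" | "x \<notin> {1..n}" by fastforce
  then show "w x = w' x"
  proof cases
    case 1
    then show ?thesis using w im by (intro eq[of 1 p]) (auto simp: shuffle_perms_def)
  next
    case 2
    then show ?thesis
      using w im compl[OF w(1)] compl[OF w(2)] by (intro eq[of "p + 1" n]) (auto simp: shuffle_perms_def)
  next
    case 3
    then show ?thesis using w unfolding shuffle_perms_def by (metis (mono_tags, lifting) mem_Collect_eq permutes_not_in)
  qed
qed

text \<open>An ascending letter exchanges a value \<open>i\<close> of the first block with the value
  \<open>Suc i\<close> outside it. There is nothing between adjacent values, so the order inside
  each block persists.\<close>

lemma perm_word_mem_shuffle_perms: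
  "set is \<subseteq> {1..<n} \<Longrightarrow> p \<le> n \<Longrightarrow> ascending_word {1..p} is \<Longrightarrow> perm_word is \<in> shuffle_perms p n"
proof (induction "is")
  case Nil
  show ?case using permutes_id by (auto simp: shuffle_perms_def strict_mono_on_def id_def)
next
  case (Cons i "is")
  let ?w = "perm_word is" and ?t = "Transposition.transpose i (Suc i)"
  have w: "?w permutes {1..n}" "strict_mono_on {1..p} ?w" "strict_mono_on {p + 1..n} ?w"
    using Cons by (auto simp: shuffle_perms_def)
  have i: "i \<in> ?w ` {1..p}" "Suc i \<notin> ?w ` {1..p}" using Cons.prems by simp_all
  have "?w x \<noteq> i" if "x \<in> {p + 1..n}" for x
  proof
    assume "?w x = i"
    moreover obtain y where "y \<in> {1..p}" "?w y = i" using i(1) by blast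
    ultimately have "x = y" using permutes_inj[OF w(1)] by (metis injD)
    then show False using that \<open>y \<in> {1..p}\<close> by simp
  qed
  then have 2: "strict_mono_on {p + 1..n} (?t \<circ> ?w)"
    using w(3) unfolding strict_mono_on_def Transposition.transpose_def o_def
    by (smt (verit, best) less_Suc_eq not_less_eq order_less_trans)
  have "?w x \<noteq> Suc i" if "x \<in> {1..p}" for x using i(2) that by (metis imageI)
  then have 1: "strict_mono_on {1..p} (?t \<circ> ?w)"
    using w(2) unfolding strict_mono_on_def Transposition.transpose_def o_def
    by (smt (verit, best) Suc_lessI less_SucI)
  show ?case
    unfolding shuffle_perms_def perm_word_Cons
    using 1 2 perm_word_permutes[OF Cons.prems(1), unfolded perm_word_Cons] by blast
qed

text \<open>\<open>js\<close> attains the bound for the sum over the image of the first block. A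
  reduced word has the same image and is not longer than \<open>js\<close>, so it must attain the
  bound too.\<close>

lemma reduced_word_ascending:
  assumes "reduced_word n w is" "set js \<subseteq> {1..<n}" "perm_word js = w" "ascending_word {1..p} js"
  shows "ascending_word {1..p} is"
proof -
  have "length is \<le> length js" "perm_word is = w" using assms by (auto simp: reduced_word_def)
  moreover have "\<Sum> (w ` {1..p}) = \<Sum> {1..p} + length js"
    using sum_image_perm_word(2)[of "{1..p}" js] assms by simp
  moreover have "\<Sum> (w ` {1..p}) \<le> \<Sum> {1..p} + length is"
    using sum_image_perm_word(1)[of "{1..p}" "is"] \<open>perm_word is = w\<close> by simp
  ultimately show ?thesis using sum_image_perm_word(2)[of "{1..p}" "is"] by simp
qed

lemma reduced_word_exists:
  assumes "set js \<subseteq> {1..<n}" "perm_word js = w"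
  shows "\<exists>is. reduced_word n w is"
  using ex_has_least_nat[of "\<lambda>is. set is \<subseteq> {1..<n} \<and> perm_word is = w" js length] assms
  unfolding reduced_word_def by blast

section \<open>Action of the ascending words of a shuffle\<close>

context
  fixes scale :: "'k::field \<Rightarrow> 'a::ab_group_add \<Rightarrow> 'a"
    and \<sigma> :: "('a list \<Rightarrow>\<^sub>0 'k) set \<Rightarrow> ('a list \<Rightarrow>\<^sub>0 'k) set"
  assumes \<sigma>: "tlinear scale 2 2 \<sigma>"
begin

text \<open>
  Shuffles are fully commutative: two different descents \<open>i\<close> and \<open>j\<close> of the image of the first
  block satisfy \<open>\<bar>i - j\<bar> \<ge> 2\<close>, so only commutations, but no braid moves, are needed.
\<close>

lemma ascending_word_exchange:
  assumes "set is \<subseteq> {1..<n}" "ascending_word {1..p} is" "0 < j" "j < n"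
    and "j \<notin> perm_word is ` {1..p}" "Suc j \<in> perm_word is ` {1..p}"
  shows "\<exists>js. set js \<subseteq> {1..<n} \<and> ascending_word {1..p} (j # js) \<and>
    perm_word (j # js) ` {1..p} = perm_word is ` {1..p} \<and>
    (\<forall>X\<in>tpow scale n. sigma_word scale \<sigma> n is X = sigma_word scale \<sigma> n (j # js) X)"
  using assms
proof (induction "is")
  case (Cons i "is")
  let ?t = "\<lambda>i. Transposition.transpose i (Suc i)"
  let ?T' = "perm_word is ` {1..p}"
  have T: "perm_word (i # is) ` {1..p} = ?t i ` ?T'" by (rule image_perm_word_Cons)
  have asc: "ascending_word {1..p} is" "i \<in> ?T'" "Suc i \<notin> ?T'" using Cons.prems by auto
  have i: "0 < i" "i < n" "set is \<subseteq> {1..<n}" using Cons.prems by auto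
  have j: "?t i j \<notin> ?T'" "?t i (Suc j) \<in> ?T'"
    using Cons.prems(5,6) unfolding T mem_image_transpose by auto
  show ?case
  proof (cases "i = j")
    case True
    then show ?thesis using Cons.prems i by (intro exI[of _ "is"]) auto
  next
    case False
    \<comment> \<open>Neighbouring letters are excluded: for \<open>j = Suc i\<close> the first fact
      in \<open>j\<close> would put \<open>i\<close> outside \<open>?T'\<close>, for
      \<open>i = Suc j\<close> the second would put \<open>Suc i\<close> inside.\<close>
    then have far: "j \<noteq> Suc i" "i \<noteq> Suc j" using j asc by (auto simp: Transposition.transpose_def)
    then have "j \<notin> ?T'" "Suc j \<in> ?T'" using j False by (auto simp: Transposition.transpose_def)
    \<comment> \<open>The induction hypothesis brings \<open>j\<close> to the front of
      \<open>is\<close>; being far from \<open>i\<close>, it can then be exchanged with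
      \<open>i\<close>.\<close>
    then obtain js where js: "set js \<subseteq> {1..<n}" "ascending_word {1..p} (j # js)"
        "perm_word (j # js) ` {1..p} = ?T'"
        "\<forall>X\<in>tpow scale n. sigma_word scale \<sigma> n is X = sigma_word scale \<sigma> n (j # js) X"
      using Cons.IH[OF i(3) asc(1)] Cons.prems by auto
    let ?T'' = "perm_word js ` {1..p}"
    have T': "?T' = ?t j ` ?T''" using js(3) by (simp only: image_perm_word_Cons)
    have fix_j: "?t j i = i" "?t j (Suc i) = Suc i" and fix_i: "?t i j = j" "?t i (Suc j) = Suc j"
      using False far by (auto simp: Transposition.transpose_def)
    have "i \<in> ?T''" "Suc i \<notin> ?T''" using asc fix_j unfolding T' mem_image_transpose by auto
    then have a1: "ascending_word {1..p} (i # js)" using js(2) by simp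
    have im: "perm_word (i # js) ` {1..p} = ?t i ` ?T''" by (rule image_perm_word_Cons)
    have a2: "ascending_word {1..p} (j # i # js)"
      unfolding ascending_word.simps(2)[of _ j] im mem_image_transpose fix_i using a1 js(2) by simp
    have "?t i \<circ> ?t j = ?t j \<circ> ?t i"
      using False far by (auto simp: fun_eq_iff Transposition.transpose_def)
    then have "?t j ` ?t i ` ?T'' = ?t i ` ?t j ` ?T''" by (metis image_comp)
    then have a3: "perm_word (j # i # js) ` {1..p} = perm_word (i # is) ` {1..p}"
      unfolding T T' by (simp only: image_perm_word_Cons)
    have "sigma_word scale \<sigma> n (i # is) X = sigma_word scale \<sigma> n (j # i # js) X"
      if X: "X \<in> tpow scale n" for X
    proof -
      have "sigma_word scale \<sigma> n js X \<in> tpow scale n"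
        using tlinear_mem[OF tlinear_sigma_word[OF \<sigma> js(1)] X] .
      then show ?thesis
        using sigma_at_commute[OF \<sigma>, of i j n] sigma_at_commute[OF \<sigma>, of j i n] js(4) X
          far False i Cons.prems(3,4)
        by (cases "i < j") (auto simp: sigma_word_Cons[OF \<sigma>])
    qed
    then show ?thesis using a2 a3 js(1) i by (intro exI[of _ "i # js"]) auto
  qed
qed auto

text \<open>The first letter \<open>i\<close> of an ascending word has just moved an element to
  \<open>Suc i\<close>, so the common image contains \<open>Suc i\<close> but not \<open>i\<close>.
  The exchange lemma brings \<open>i\<close> to the front of \<open>js\<close>, and the tails have
  equal images again.\<close>

lemma sigma_word_ascending_cong:
  assumes "set is \<subseteq> {1..<n}" "ascending_word {1..p} is"
    and "set js \<subseteq> {1..<n}" "ascending_word {1..p} js"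
    and "perm_word is ` {1..p} = perm_word js ` {1..p}" and X: "X \<in> tpow scale n"
  shows "sigma_word scale \<sigma> n is X = sigma_word scale \<sigma> n js X"
  using assms(1-5)
proof (induction "is" arbitrary: js)
  let ?t = "\<lambda>i. Transposition.transpose i (Suc i)"
  case Nil
  show ?case
  proof (cases js)
    case (Cons j js')
    have "j \<notin> perm_word js ` {1..p}" "Suc j \<in> perm_word js ` {1..p}"
      using Nil(4) unfolding Cons image_perm_word_Cons mem_image_transpose by simp_all
    \<comment> \<open>Impossible because letters are at least 1; hence \<open>js\<close> is empty as
      well.\<close>
    then have "j \<notin> {1..p}" "Suc j \<in> {1..p}" using Nil(5) by simp_all
    then show ?thesis using Nil Cons by auto
  qed simp
next
  let ?t = "\<lambda>i. Transposition.transpose i (Suc i)"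
  case (Cons i "is")
  have T: "perm_word (i # is) ` {1..p} = ?t i ` perm_word is ` {1..p}" for "is"
    by (rule image_perm_word_Cons)
  have "i \<notin> perm_word (i # is) ` {1..p}" "Suc i \<in> perm_word (i # is) ` {1..p}"
    using Cons.prems(2) unfolding T mem_image_transpose by auto
  then obtain js' where js': "set js' \<subseteq> {1..<n}" "ascending_word {1..p} (i # js')"
    "perm_word (i # js') ` {1..p} = perm_word js ` {1..p}"
    "sigma_word scale \<sigma> n js X = sigma_word scale \<sigma> n (i # js') X"
    using ascending_word_exchange[OF Cons.prems(3,4), of i] Cons.prems X by auto
  have "?t i ` perm_word is ` {1..p} = ?t i ` perm_word js' ` {1..p}"
    using js'(3) Cons.prems(5) unfolding T by simp
  then have "perm_word is ` {1..p} = perm_word js' ` {1..p}"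
    by (simp add: inj_image_eq_iff)
  then have "sigma_word scale \<sigma> n is X = sigma_word scale \<sigma> n js' X"
    using Cons.prems js' by (intro Cons.IH) auto
  then show ?case using js'(4) by (simp add: sigma_word_Cons[OF \<sigma>])
qed

text \<open>The decomposition picked by \<open>SOME\<close> is reduced, hence ascending by
  comparison with \<open>js\<close>, and therefore acts like \<open>js\<close>.\<close>

lemma
  assumes "set js \<subseteq> {1..<n}" "perm_word js = w"
  shows tlinear_T_perm: "tlinear scale n n (T_perm scale \<sigma> n w)"
    and T_perm_ascending: "ascending_word {1..p} js \<Longrightarrow> X \<in> tpow scale n \<Longrightarrow>
      T_perm scale \<sigma> n w X = sigma_word scale \<sigma> n js X"
proof -
  define js' where "js' = (SOME is. reduced_word n w is)"
  have red: "reduced_word n w js'"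
    unfolding js'_def by (rule someI_ex[OF reduced_word_exists[OF assms]])
  then have "set js' \<subseteq> {1..<n}" "perm_word js' = w" by (auto simp: reduced_word_def)
  then show "tlinear scale n n (T_perm scale \<sigma> n w)"
    unfolding T_perm_def js'_def[symmetric] by (intro tlinear_sigma_word[OF \<sigma>])
  show "T_perm scale \<sigma> n w X = sigma_word scale \<sigma> n js X"
    if "ascending_word {1..p} js" "X \<in> tpow scale n"
    unfolding T_perm_def js'_def[symmetric]
    using reduced_word_ascending[OF red assms that(1)] \<open>set js' \<subseteq> _\<close> \<open>perm_word js' = w\<close> assms that
    by (intro sigma_word_ascending_cong[of _ _ p]) auto
qed

end

section \<open>Deletion of units\<close>

text \<open>
  \<open>unit_reduction L is L' js\<close>: the letters of \<open>is\<close>, the last one first, turn the pattern \<open>L\<close> into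
  \<open>L'\<close>; deleting the transpositions that move a unit leaves the word \<open>js\<close> on the labelled
  positions. The labels tell the letters of the first word (\<open>True\<close>) from those of the second.
\<close>

inductive unit_reduction :: "bool option list \<Rightarrow> nat list \<Rightarrow> bool option list \<Rightarrow> nat list \<Rightarrow> bool"
  for L where
  Nil: "unit_reduction L [] L []"
| unit: "unit_reduction L is (P @ [u, v] @ Q) js \<Longrightarrow> u = None \<or> v = None \<Longrightarrow>
    unit_reduction L (Suc (length P) # is) (P @ [v, u] @ Q) js"
| labels: "unit_reduction L is (P @ [Some True, Some False] @ Q) js \<Longrightarrow>
    unit_reduction L (Suc (length P) # is) (P @ [Some False, Some True] @ Q)
      (Suc (length (labels P)) # js)"

lemma unit_reduction_lengths:
  assumes "unit_reduction L is L' js"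
  shows "length L' = length L" "length (labels L') = length (labels L)"
    "set is \<subseteq> {1..<length L}" "set js \<subseteq> {1..<length (labels L)}"
proof -
  have "length L' = length L \<and> length (labels L') = length (labels L) \<and>
    set is \<subseteq> {1..<length L} \<and> set js \<subseteq> {1..<length (labels L)}"
    using assms
  proof induction
    case (unit "is" P u v Q js)
    then show ?case by (cases u; cases v) auto
  qed auto
  then show "length L' = length L" "length (labels L') = length (labels L)"
    "set is \<subseteq> {1..<length L}" "set js \<subseteq> {1..<length (labels L)}" by auto
qed

text \<open>Each rule of the relation is one way of moving \<open>sigma_at\<close> through
  \<open>insert_ones\<close>: next to a unit the letter vanishes, between two labels it becomes a
  letter on the labelled places.\<close>

lemma sigma_word_unit_reduction:
  fixes scale :: "'k::field \<Rightarrow> 'a::ab_group_add \<Rightarrow> 'a"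
  assumes \<sigma>: "tlinear scale 2 2 \<sigma>"
    and unit: "\<And>a. \<sigma> (tens scale [a, one]) = tens scale [one, a]"
      "\<And>a. \<sigma> (tens scale [one, a]) = tens scale [a, one]"
    and red: "unit_reduction L is L' js" and X: "X \<in> tpow scale (length (labels L))"
  shows "sigma_word scale \<sigma> (length L) is (insert_ones scale one L X)
    = insert_ones scale one L' (sigma_word scale \<sigma> (length (labels L)) js X)"
  using red
proof induction
  case Nil
  show ?case by (simp add: sigma_word_Nil[OF \<sigma>])
next
  case (unit "is" P u v Q js)
  note len = unit_reduction_lengths[OF unit(1)]
  have "sigma_word scale \<sigma> (length (labels L)) js X \<in> tpow scale (length (labels (P @ [u, v] @ Q)))"
    using tlinear_mem[OF tlinear_sigma_word[OF \<sigma> len(4)] X] len(2) by simp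
  from sigma_at_insert_ones_unit[OF \<sigma> assms(2,3) unit(2) _ this, of "length L"]
  show ?case using len(1) unit.IH by (simp add: sigma_word_Cons[OF \<sigma>])
next
  case (labels "is" P Q js)
  note len = unit_reduction_lengths[OF labels(1)]
  note tlinear_mem[OF tlinear_sigma_word[OF \<sigma> len(4)] X]
  from sigma_at_insert_ones_labels[OF \<sigma> _ _ this, of "length L" P Q one True False]
  show ?case using len(1,2) labels.IH by (simp add: sigma_word_Cons[OF \<sigma>])
qed

text \<open>Places are counted from 1, like the points on which permutations act. For the labels of
  a pattern these are the places of the letters of the first word.\<close>

definition true_positions :: "bool list \<Rightarrow> nat set" where
  "true_positions bs = {Suc i | i. i < length bs \<and> bs ! i}"

lemma mem_true_positions: "x \<in> true_positions bs \<longleftrightarrow> 0 < x \<and> x \<le> length bs \<and> bs ! (x - 1)"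
  by (cases x) (auto simp: true_positions_def Suc_le_eq)

lemma true_positions_swap:
  assumes "i = Suc (length as)"
  shows "i \<in> true_positions (as @ [True, False] @ bs)"
    and "Suc i \<notin> true_positions (as @ [True, False] @ bs)"
    and "true_positions (as @ [False, True] @ bs)
      = Transposition.transpose i (Suc i) ` true_positions (as @ [True, False] @ bs)"
proof -
  show "i \<in> true_positions (as @ [True, False] @ bs)"
    "Suc i \<notin> true_positions (as @ [True, False] @ bs)"
    using assms by (auto simp: mem_true_positions nth_append)
  show "true_positions (as @ [False, True] @ bs)
      = Transposition.transpose i (Suc i) ` true_positions (as @ [True, False] @ bs)"
  proof (rule set_eqI)
    fix x
    consider "x < i" | "x = i" | "x = Suc i" | "Suc (Suc i) \<le> x"
      by linarith
    then show "x \<in> true_positions (as @ [False, True] @ bs) \<longleftrightarrow>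
        x \<in> Transposition.transpose i (Suc i) ` true_positions (as @ [True, False] @ bs)"
      unfolding mem_image_transpose mem_true_positions
      using assms by cases (auto simp: nth_append nth_Cons' Transposition.transpose_def)
  qed
qed

lemma true_positions_replicate:
  "true_positions (replicate p True @ replicate q False) = {1..p}"
  by (auto simp: mem_true_positions nth_append split: if_splits)

text \<open>The rule \<open>labels\<close> requires \<open>True\<close> followed by
  \<open>False\<close>: the letter is in the current set and its successor is not, as
  \<open>ascending_word\<close> demands. Steps through units leave the labels unchanged.\<close>

lemma unit_reduction_ascending:
  assumes "unit_reduction L is L' js" "true_positions (labels L) = S"
  shows "ascending_word S js \<and> true_positions (labels L') = perm_word js ` S"
  using assms(1)
proof induction
  case Nil
  show ?case using assms(2) by simp
next
  case (unit "is" P u v Q js)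
  have "labels (P @ [v, u] @ Q) = labels (P @ [u, v] @ Q)" using unit(2) by (cases u; cases v) auto
  then show ?case using unit.IH by simp
next
  case (labels "is" P Q js)
  then show ?case
    using true_positions_swap[of "Suc (length (labels P))" "labels P" "labels Q"] by simp
qed

text \<open>\<open>y\<close> travels to the left end of \<open>M\<close> and passes the last entry
  of \<open>M\<close> first. As the last index of the list acts first, the indices appear in
  increasing order. The only two labels that can meet are \<open>Some True\<close> and
  \<open>Some False\<close>, in this order.\<close>

lemma unit_reduction_move:
  assumes "unit_reduction L is (P @ M @ [y] @ Q) js"
    and "set M \<subseteq> {None, Some True}" "y \<in> {None, Some False}"
  shows "\<exists>js. unit_reduction L ([Suc (length P)..<Suc (length P) + length M] @ is) (P @ [y] @ M @ Q) js"
  using assms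
proof (induction M arbitrary: "is" Q js rule: rev_induct)
  case Nil
  then show ?case by auto
next
  case (snoc m M)
  have red: "unit_reduction L is ((P @ M) @ [m, y] @ Q) js" using snoc.prems by simp
  have "\<exists>js. unit_reduction L (Suc (length (P @ M)) # is) ((P @ M) @ [y, m] @ Q) js"
  proof (cases "m = None \<or> y = None")
    case True
    then show ?thesis using unit_reduction.unit[OF red] by blast
  next
    case False
    then have "m = Some True" "y = Some False" using snoc.prems by auto
    then show ?thesis using unit_reduction.labels red by blast
  qed
  then obtain js' where "unit_reduction L (Suc (length (P @ M)) # is) (P @ M @ [y] @ (m # Q)) js'"
    by auto
  from snoc.IH[OF this] snoc.prems
  obtain js'' where "unit_reduction L ([Suc (length P)..<Suc (length P) + length M]
      @ Suc (length (P @ M)) # is) (P @ [y] @ M @ m # Q) js''" by auto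
  then show ?case by (auto intro!: exI[of _ js''])
qed

text \<open>The word of \<open>\<psi>\<close> moves the letters of \<open>ys\<close> one by one next to their partners in \<open>xs\<close>.\<close>

lemma unit_reduction_interleave:
  assumes xs: "length xs = n" "set xs \<subseteq> {None, Some True}"
    and ys: "length ys = n" "set ys \<subseteq> {None, Some False}"
  shows "\<exists>js. unit_reduction (xs @ ys) (concat (map (\<lambda>k. [2 * k..<n + k]) (rev [1..<n])))
    (concat (map (\<lambda>i. [xs ! i, ys ! i]) [0..<n])) js"
proof -
  let ?I = "\<lambda>r. concat (map (\<lambda>i. [xs ! i, ys ! i]) [0..<r])"
  have len: "length (?I r) = 2 * r" for r by (induction r) auto
  \<comment> \<open>Invariant: after \<open>r\<close> factors of the word the first \<open>r\<close>
    pairs are complete, and the rests of both lists follow unchanged.\<close>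
  have "\<exists>js. unit_reduction (xs @ ys) (concat (map (\<lambda>k. [2 * k..<n + k]) (rev [1..<Suc r])))
    (?I r @ drop r xs @ drop r ys) js" if "r \<le> n - 1" for r
    using that
  proof (induction r)
    case 0
    then show ?case using unit_reduction.Nil by auto
  next
    case (Suc r)
    then have r: "r < n" by simp
    then have d: "drop r xs = xs ! r # drop (Suc r) xs" "drop r ys = ys ! r # drop (Suc r) ys"
      using xs ys by (auto simp: Cons_nth_drop_Suc)
    let ?w = "concat (map (\<lambda>k. [2 * k..<n + k]) (rev [1..<Suc r]))" and ?P = "?I r @ [xs ! r]"
    obtain js where "unit_reduction (xs @ ys) ?w (?I r @ drop r xs @ drop r ys) js"
      using Suc by auto
    then have red: "unit_reduction (xs @ ys) ?w (?P @ drop (Suc r) xs @ [ys ! r] @ drop (Suc r) ys) js"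
      unfolding d by simp
    have "set (drop (Suc r) xs) \<subseteq> {None, Some True}" using xs(2) set_drop_subset by fast
    moreover have "ys ! r \<in> {None, Some False}" using ys r nth_mem by blast
    ultimately obtain js' where red': "unit_reduction (xs @ ys)
        ([Suc (length ?P)..<Suc (length ?P) + length (drop (Suc r) xs)] @ ?w)
        (?P @ [ys ! r] @ drop (Suc r) xs @ drop (Suc r) ys) js'"
      using unit_reduction_move[OF red] by blast
    \<comment> \<open>\<open>?P\<close> has \<open>2 * r + 1\<close> entries, and the letter passes
      the \<open>n - r - 1\<close> remaining entries of \<open>xs\<close>; this is the factor of
      \<open>\<psi>\<close> for \<open>k = r + 1\<close>.\<close>
    have "[Suc (length ?P)..<Suc (length ?P) + length (drop (Suc r) xs)] = [2 * Suc r..<n + Suc r]"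
      using r xs(1) len by (simp add: add.commute)
    then have "[Suc (length ?P)..<Suc (length ?P) + length (drop (Suc r) xs)] @ ?w
        = concat (map (\<lambda>k. [2 * k..<n + k]) (rev [1..<Suc (Suc r)]))" by simp
    moreover have "?P @ [ys ! r] @ drop (Suc r) xs @ drop (Suc r) ys
        = ?I (Suc r) @ drop (Suc r) xs @ drop (Suc r) ys" by simp
    ultimately show ?case using red' by metis
  qed
  from this[of "n - 1"] obtain js where red: "unit_reduction (xs @ ys)
      (concat (map (\<lambda>k. [2 * k..<n + k]) (rev [1..<Suc (n - 1)])))
      (?I (n - 1) @ drop (n - 1) xs @ drop (n - 1) ys) js" by auto
  show ?thesis
  proof (cases n)
    case 0
    then show ?thesis using xs ys unit_reduction.Nil by auto
  next
    case (Suc m)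
    \<comment> \<open>The last letter of \<open>ys\<close> already stands next to its partner, so
      \<open>n - 1\<close> factors are enough.\<close>
    then have "drop m xs = [xs ! m]" "drop m ys = [ys ! m]"
      using xs ys by (auto simp: Cons_nth_drop_Suc[symmetric])
    then show ?thesis using red Suc by auto
  qed
qed


section \<open>Factorization of the quantum shuffle product\<close>

lemma qsum_mem_qcar:
  assumes N: "pm.subspace N" and X: "\<And>i. i \<in> I \<Longrightarrow> X i \<in> qcar N E"
  shows "qsum N (\<lambda>i. qscale N (c i) (X i)) I \<in> qcar N E"
proof -
  have "\<forall>i. \<exists>x. i \<in> I \<longrightarrow> Poly_Mapping.keys x \<subseteq> E \<and> X i = coset N x" using X by (meson qcarE)
  then obtain x where x: "\<And>i. i \<in> I \<Longrightarrow> Poly_Mapping.keys (x i) \<subseteq> E"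
    "\<And>i. i \<in> I \<Longrightarrow> X i = coset N (x i)" by metis
  have "qsum N (\<lambda>i. qscale N (c i) (X i)) I = coset N (\<Sum>i\<in>I. pm_scale (c i) (x i))"
    using x(2) N by (intro qsum_coset') auto
  then show ?thesis using qcarI[OF keys_sum_scale[of I x E c, OF x(1)]] by simp
qed

lemma linear_into_qsum:
  fixes N :: "('x \<Rightarrow>\<^sub>0 'k::field) set"
  assumes N: "pm.subspace N" and g: "\<And>i. i \<in> I \<Longrightarrow> linear_into scale N (g i)"
    and car: "\<And>i a. i \<in> I \<Longrightarrow> g i a \<in> qcar N UNIV"
  shows "linear_into scale N (\<lambda>a. qsum N (\<lambda>i. qscale N (c i) (g i a)) I)"
proof -
  have "\<forall>i a. \<exists>x. i \<in> I \<longrightarrow> g i a = coset N x" using car by (meson qcarE)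
  then obtain h where h: "\<And>i a. i \<in> I \<Longrightarrow> g i a = coset N (h i a)" by metis
  have sum: "qsum N (\<lambda>i. qscale N (c i) (g i a)) I = coset N (\<Sum>i\<in>I. pm_scale (c i) (h i a))" for a
    using h N by (intro qsum_coset') auto
  have add: "coset N (h i (a + b)) = coset N (h i a + h i b)" if "i \<in> I" for i a b
    using g[OF that] h[OF that] N by (simp add: linear_into_def)
  have scale: "coset N (h i (scale d a)) = coset N (pm_scale d (h i a))" if "i \<in> I" for i a d
    using g[OF that] h[OF that] N by (simp add: linear_into_def)
  have 1: "coset N (\<Sum>i\<in>I. pm_scale (c i) (h i (a + b)))
      = coset N ((\<Sum>i\<in>I. pm_scale (c i) (h i a)) + (\<Sum>i\<in>I. pm_scale (c i) (h i b)))" for a b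
    unfolding sum.distrib[symmetric] pm.scale_right_distrib[symmetric]
    by (intro coset_sum_cong coset_scale_cong N add)
  have 2: "coset N (\<Sum>i\<in>I. pm_scale (c i) (h i (scale d a)))
      = coset N (pm_scale d (\<Sum>i\<in>I. pm_scale (c i) (h i a)))" for a d
  proof -
    have "coset N (\<Sum>i\<in>I. pm_scale (c i) (h i (scale d a)))
        = coset N (\<Sum>i\<in>I. pm_scale (c i) (pm_scale d (h i a)))"
      by (intro coset_sum_cong coset_scale_cong N scale)
    also have "(\<Sum>i\<in>I. pm_scale (c i) (pm_scale d (h i a))) = pm_scale d (\<Sum>i\<in>I. pm_scale (c i) (h i a))"
      by (simp only: pm.scale_sum_right pm.scale_left_commute)
    finally show ?thesis .
  qed
  show ?thesis unfolding linear_into_def sum using 1 2 N by simp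
qed

text \<open>
  The patterns of the two tensor factors of \<open>g'\<close> belonging to \<open>w\<close>.
\<close>

definition left_pattern :: "nat \<Rightarrow> nat \<Rightarrow> (nat \<Rightarrow> nat) \<Rightarrow> bool option list" where
  "left_pattern p n w = map (\<lambda>i. if Suc i \<in> w ` {1..p} then Some True else None) [0..<n]"

definition right_pattern :: "nat \<Rightarrow> nat \<Rightarrow> (nat \<Rightarrow> nat) \<Rightarrow> bool option list" where
  "right_pattern p n w = map (\<lambda>i. if Suc i \<in> w ` {1..p} then None else Some False) [0..<n]"

lemma labels_map_if:
  "labels (map (\<lambda>i. if Q i then None else Some b) is) = replicate (length (filter (\<lambda>i. \<not> Q i) is)) b"
  by (induction "is") auto

text \<open>The values of \<open>w\<close> on the block are at least 1, so truncated subtraction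
  keeps them distinct and in order. The shift turns places counted from 1 into list indices.\<close>

lemma sorted_map_diff_one:
  assumes w: "w permutes {1..n}" "strict_mono_on {a..b} w" and "1 \<le> a" "b \<le> n"
  shows "sorted_wrt (<) (map (\<lambda>j. w j - 1) [a..<b + 1])"
    and "set (map (\<lambda>j. w j - 1) [a..<b + 1]) \<subseteq> {..<n}"
    and "x \<in> set (map (\<lambda>j. w j - 1) [a..<b + 1]) \<longleftrightarrow> Suc x \<in> w ` {a..b}"
proof -
  have pos: "w j \<in> {1..n}" if "j \<in> {a..b}" for j
    using that assms permutes_in_image[OF w(1), of j] by auto
  have "w i - 1 < w j - 1" if "i < j" "a \<le> i" "j \<le> b" for i j
  proof -
    have "w i < w j" using w(2) that by (auto simp: strict_mono_on_def)
    moreover have "1 \<le> w i" using pos[of i] that by simp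
    ultimately show ?thesis by simp
  qed
  then show "sorted_wrt (<) (map (\<lambda>j. w j - 1) [a..<b + 1])"
    unfolding sorted_wrt_map by (intro sorted_wrt_mono_rel[OF _ sorted_wrt_upt]) auto
  have set: "set (map (\<lambda>j. w j - 1) [a..<b + 1]) = (\<lambda>j. w j - 1) ` {a..b}"
    by (simp add: atLeastLessThanSuc_atLeastAtMost del: upt_Suc)
  show "set (map (\<lambda>j. w j - 1) [a..<b + 1]) \<subseteq> {..<n}"
    unfolding set using pos by fastforce
  have "x \<in> (\<lambda>j. w j - 1) ` {a..b} \<longleftrightarrow> (\<exists>j\<in>{a..b}. x = w j - 1)" by blast
  also have "\<dots> \<longleftrightarrow> (\<exists>j\<in>{a..b}. Suc x = w j)"
    using pos by (intro bex_cong refl) fastforce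
  finally show "x \<in> set (map (\<lambda>j. w j - 1) [a..<b + 1]) \<longleftrightarrow> Suc x \<in> w ` {a..b}"
    unfolding set by blast
qed

text \<open>Within a block the indices \<open>w j - 1\<close> increase, so the composites of the
  \<open>s'\<close> are insertions along a pattern.\<close>

lemma
  assumes w: "w \<in> shuffle_perms p n" and p: "p \<le> n"
  shows labels_left_pattern: "labels (left_pattern p n w) = replicate p True"
    and labels_right_pattern: "labels (right_pattern p n w) = replicate (n - p) False"
    and insert_units_left_pattern: "length as = p \<Longrightarrow> insert_units scale one p (map (\<lambda>j. w j - 1) [p + 1..<n + 1]) (tens scale as)
      = tens scale (fill one (left_pattern p n w) as)"
    and insert_units_right_pattern: "length bs = n - p \<Longrightarrow> insert_units scale one (n - p) (map (\<lambda>j. w j - 1) [1..<p + 1]) (tens scale bs)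
      = tens scale (fill one (right_pattern p n w) bs)"
proof -
  let ?l = "map (\<lambda>j. w j - 1) [p + 1..<n + 1]" and ?r = "map (\<lambda>j. w j - 1) [1..<p + 1]"
  have perm: "w permutes {1..n}" "strict_mono_on {1..p} w" "strict_mono_on {p + 1..n} w"
    using w by (auto simp: shuffle_perms_def)
  note l = sorted_map_diff_one[OF perm(1,3)] and r = sorted_map_diff_one[OF perm(1,2) _ p]
  \<comment> \<open>The left factor receives its units at the images of the second block; these are
    exactly the places not taken by the first block.\<close>
  have "Suc i \<in> w ` {p + 1..n} \<longleftrightarrow> Suc i \<notin> w ` {1..p}" if "i < n" for i
  proof -
    have v: "inj w" "w ` {1..n} = {1..n}" using permutes_inj[OF perm(1)] permutes_image[OF perm(1)] .
    have "{p + 1..n} = {1..n} - {1..p}" using p by auto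
    then have "w ` {p + 1..n} = {1..n} - w ` {1..p}"
      using image_set_diff[OF v(1), of "{1..n}" "{1..p}"] v(2) by simp
    then show ?thesis using that by auto
  qed
  then have L: "left_pattern p n w = map (\<lambda>i. if i \<in> set ?l then None else Some True) [0..<n]"
    unfolding left_pattern_def using l(3) by (intro map_cong refl) auto
  have R: "right_pattern p n w = map (\<lambda>i. if i \<in> set ?r then None else Some False) [0..<n]"
    unfolding right_pattern_def using r(3) by (intro map_cong refl) auto
  have dist: "distinct ?l" "distinct ?r"
    using l(1) r(1) strict_sorted_iff by (metis le_add2 order_refl)+
  have sub: "set ?l \<subseteq> {..<n}" "set ?r \<subseteq> {..<n}" using l(2) r(2) by auto
  have len: "length ?l = n - p" "length ?r = p" by (simp_all del: upt_Suc)
  have "length (labels (left_pattern p n w)) = p"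
    unfolding L length_labels_complement[OF dist(1) sub(1)] len using p by simp
  then show "labels (left_pattern p n w) = replicate p True"
    unfolding L labels_map_if by simp
  have "length (labels (right_pattern p n w)) = n - p"
    unfolding R length_labels_complement[OF dist(2) sub(2)] len by simp
  then show "labels (right_pattern p n w) = replicate (n - p) False"
    unfolding R labels_map_if by simp
  show "insert_units scale one p ?l (tens scale as) = tens scale (fill one (left_pattern p n w) as)"
    if "length as = p"
    unfolding insert_units_tens[OF that] L
    using l(1) sub(1) len that p by (subst foldl_insert_eq_fill[where b = True]) auto
  show "insert_units scale one (n - p) ?r (tens scale bs) = tens scale (fill one (right_pattern p n w) bs)"
    if "length bs = n - p"
    unfolding insert_units_tens[OF that] R
    using r(1) sub(2) len that p by (subst foldl_insert_eq_fill[where b = False]) auto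
qed

context unital_algebra
begin

lemma pair_products_fill:
  "length as = length is \<Longrightarrow>
    pair_products mul (fill one (concat (map (\<lambda>i. if Q i then [Some b, None] else [None, Some c]) is)) as) = as"
  by (induction "is" arbitrary: as) (auto simp: length_Suc_conv)

text \<open>The comparison for a single shuffle and a single pair of words. The bound on
  \<open>\<Psi>\<close> and the linearity of \<open>T_perm\<close> come out of the same unit
  reduction, which supplies a word for \<open>w\<close>.\<close>

lemma mul_pow_sigma_word_shuffle:
  fixes \<sigma> :: "('a list \<Rightarrow>\<^sub>0 'k) set \<Rightarrow> ('a list \<Rightarrow>\<^sub>0 'k) set"
  assumes \<sigma>: "tlinear scale 2 2 \<sigma>"
    and unit: "\<And>a. \<sigma> (tens scale [a, one]) = tens scale [one, a]"
      "\<And>a. \<sigma> (tens scale [one, a]) = tens scale [a, one]"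
    and w: "w \<in> shuffle_perms p n" and p: "p \<le> n"
  defines "\<Psi> \<equiv> concat (map (\<lambda>k. [2 * k..<n + k]) (rev [1..<n]))"
  shows "set \<Psi> \<subseteq> {1..<2 * n}" and "tlinear scale n n (T_perm scale \<sigma> n w)"
    and "length as = p \<Longrightarrow> length bs = n - p \<Longrightarrow>
      mul_pow scale mul n (sigma_word scale \<sigma> (2 * n) \<Psi>
        (tens scale (fill one (left_pattern p n w) as @ fill one (right_pattern p n w) bs)))
      = T_perm scale \<sigma> n w (tens scale (as @ bs))"
proof -
  let ?xs = "left_pattern p n w" and ?ys = "right_pattern p n w"
  have len: "length ?xs = n" "length ?ys = n" by (simp_all add: left_pattern_def right_pattern_def)
  have sets: "set ?xs \<subseteq> {None, Some True}" "set ?ys \<subseteq> {None, Some False}"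
    by (auto simp: left_pattern_def right_pattern_def)
  have labels: "labels (?xs @ ?ys) = replicate p True @ replicate (n - p) False"
    using labels_left_pattern[OF w p] labels_right_pattern[OF w p] by simp
  then have k: "length (labels (?xs @ ?ys)) = n" using p by simp
  let ?L = "concat (map (\<lambda>i. if Suc i \<in> w ` {1..p} then [Some True, None] else [None, Some False]) [0..<n])"
  have L: "concat (map (\<lambda>i. [?xs ! i, ?ys ! i]) [0..<n]) = ?L"
    by (intro arg_cong[of _ _ concat] map_cong refl) (simp add: left_pattern_def right_pattern_def)
  obtain js where red: "unit_reduction (?xs @ ?ys) \<Psi> ?L js"
    using unit_reduction_interleave[OF len(1) sets(1) len(2) sets(2)] unfolding L \<Psi>_def by blast
  note lens = unit_reduction_lengths[OF red]
  show \<Psi>: "set \<Psi> \<subseteq> {1..<2 * n}" using lens(3) len by (simp add: mult_2)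
  have js: "set js \<subseteq> {1..<n}" using lens(4) k by simp
  have asc: "ascending_word {1..p} js" "true_positions (labels ?L) = perm_word js ` {1..p}"
    using unit_reduction_ascending[OF red, of "{1..p}"] labels true_positions_replicate by simp_all
  \<comment> \<open>In the interleaved pattern each pair contributes one label, \<open>True\<close>
    exactly at the places that \<open>w\<close> assigns to the first block.\<close>
  have "labels ?L = map (\<lambda>i. Suc i \<in> w ` {1..p}) [0..<n]"
  proof -
    have "labels (concat (map (\<lambda>i. if Q i then [Some True, None] else [None, Some False]) is)) = map Q is"
      for Q and "is" :: "nat list" by (induction "is") auto
    then show ?thesis .
  qed
  moreover have "true_positions (map (\<lambda>i. Suc i \<in> w ` {1..p}) [0..<n]) = w ` {1..p}"
  proof -
    have "w ` {1..p} \<subseteq> w ` {1..n}" using p by (intro image_mono) auto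
    also have "\<dots> = {1..n}" using w permutes_image unfolding shuffle_perms_def by blast
    finally have sub: "w ` {1..p} \<subseteq> {1..n}" .
    show ?thesis
    proof (rule set_eqI)
      fix x
      have "x \<in> {1..n}" if "x \<in> w ` {1..p}" using that sub by blast
      then show "x \<in> true_positions (map (\<lambda>i. Suc i \<in> w ` {1..p}) [0..<n]) \<longleftrightarrow> x \<in> w ` {1..p}"
        by (cases x) (auto simp: mem_true_positions)
    qed
  qed
  ultimately have "perm_word js ` {1..p} = w ` {1..p}" using asc(2) by simp
  then have pw: "perm_word js = w"
    by (intro shuffle_perms_eqI[OF perm_word_mem_shuffle_perms[OF js p asc(1)] w p])
  show "tlinear scale n n (T_perm scale \<sigma> n w)" by (rule tlinear_T_perm[OF \<sigma> js pw])
  assume as: "length as = p" "length bs = n - p"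
  let ?X = "tens scale (as @ bs)"
  have X: "?X \<in> tpow scale n" using as p by simp
  have "tens scale (fill one ?xs as @ fill one ?ys bs) = insert_ones scale one (?xs @ ?ys) ?X"
    using as k p labels_left_pattern[OF w p] by (simp add: insert_ones_tens fill_append)
  moreover have "sigma_word scale \<sigma> (2 * n) \<Psi> (insert_ones scale one (?xs @ ?ys) ?X)
      = insert_ones scale one ?L (sigma_word scale \<sigma> n js ?X)"
  proof -
    have "length (?xs @ ?ys) = 2 * n" using len by simp
    then show ?thesis using sigma_word_unit_reduction[OF \<sigma> unit red] X unfolding k by simp
  qed
  \<comment> \<open>The product of a letter with the unit beside it is the letter, so
    \<open>mul_pow\<close> undoes the insertion along \<open>?L\<close>. Linearity carries this from
    words to the tensor produced by \<open>js\<close>.\<close>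
  moreover have "mul_pow scale mul n (insert_ones scale one ?L Z) = id Z" if "Z \<in> tpow scale n" for Z
  proof (rule tlinear_eqI[OF qlinear_compose[OF _ tlinear_mul_pow] tlinear_id subspace_word_rel _ that])
    have lL: "length (labels ?L) = n" "length ?L = 2 * n" using lens k len by simp_all
    show "tlinear scale n (2 * n) (insert_ones scale one ?L)"
      using tlinear_insert_ones[of scale ?L one] unfolding lL .
    fix cs :: "'a list" assume cs: "length cs = n"
    have "mul_pow scale mul n (insert_ones scale one ?L (tens scale cs))
        = tens scale (pair_products mul (fill one ?L cs))"
      using cs lL by (simp only: insert_ones_tens mul_pow_tens length_fill)
    then show "mul_pow scale mul n (insert_ones scale one ?L (tens scale cs)) = id (tens scale cs)"
      using cs by (simp add: pair_products_fill)
  qed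
  moreover have "sigma_word scale \<sigma> n js ?X \<in> tpow scale n"
    using tlinear_mem[OF tlinear_sigma_word[OF \<sigma> js] X] .
  ultimately show "mul_pow scale mul n (sigma_word scale \<sigma> (2 * n) \<Psi>
        (tens scale (fill one ?xs as @ fill one ?ys bs))) = T_perm scale \<sigma> n w ?X"
    using T_perm_ascending[OF \<sigma> js pw asc(1) X] by simp
qed

end

text \<open>With one block empty, the image of the first block is forced. This reconciles the
  branches of \<open>quantum_shuffle\<close> for empty words with the sum over shuffles.\<close>

lemma shuffle_perms_trivial:
  assumes "p = 0 \<or> p = n"
  shows "shuffle_perms p n = {id}"
proof (intro equalityI subsetI)
  fix w assume w: "w \<in> shuffle_perms p n"
  have "id \<in> shuffle_perms p n" using permutes_id by (auto simp: shuffle_perms_def strict_mono_on_def id_def)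
  moreover have "w ` {1..p} = id ` {1..p}"
    using assms w permutes_image[of w "{1..n}"] by (auto simp: shuffle_perms_def)
  ultimately have "w = id" using w assms by (intro shuffle_perms_eqI) auto
  then show "w \<in> {id}" by simp
qed (use permutes_id in \<open>auto simp: shuffle_perms_def strict_mono_on_def id_def\<close>)

text \<open>The empty word represents the identity, so minimality of the length forces the chosen
  reduced word to be empty.\<close>

lemma T_perm_id: "T_perm scale \<sigma> n id X = X"
proof -
  define js where "js = (SOME is. reduced_word n id is)"
  have "reduced_word n id js"
    unfolding js_def by (rule someI_ex[OF reduced_word_exists[of "[]"]]) simp_all
  then have "length js \<le> length ([] :: nat list)" unfolding reduced_word_def by (metis empty_set empty_subsetI perm_word_Nil)
  then show ?thesis unfolding T_perm_def js_def[symmetric] by (simp add: sigma_word_def)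
qed

abbreviation word_pairs :: "nat \<Rightarrow> ('a list \<times> 'a list) set" where
  "word_pairs n \<equiv> {(as, bs). length as + length bs = n}"

lemma ppow_eq_qcar: "ppow scale n = qcar (pair_rel scale) (word_pairs n)"
  by (simp add: ppow_def qcar_def)

theorem theorem1p3:
  fixes scale :: "'k::field \<Rightarrow> 'a::ab_group_add \<Rightarrow> 'a"
    and mul :: "'a \<Rightarrow> 'a \<Rightarrow> 'a" and one :: 'a
    and \<sigma> :: "('a list \<Rightarrow>\<^sub>0 'k) set \<Rightarrow> ('a list \<Rightarrow>\<^sub>0 'k) set"
  assumes algebra: "unital_algebra scale mul one"
    and aut: "tensor_aut scale 2 \<sigma>"
    and braid: "\<forall>X\<in>tpow scale 3.
      sigma_at scale \<sigma> 3 2 (sigma_at scale \<sigma> 3 1 (sigma_at scale \<sigma> 3 2 X)) =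
      sigma_at scale \<sigma> 3 1 (sigma_at scale \<sigma> 3 2 (sigma_at scale \<sigma> 3 1 X))"
    and mul_left: "\<forall>X\<in>tpow scale 3.
      sigma_at scale \<sigma> 2 1 (tmap scale 2 1 (mul_map scale mul) id X) =
      tmap scale 1 2 id (mul_map scale mul) (sigma_at scale \<sigma> 3 1 (sigma_at scale \<sigma> 3 2 X))"
    and mul_right: "\<forall>X\<in>tpow scale 3.
      sigma_at scale \<sigma> 2 1 (tmap scale 1 2 id (mul_map scale mul) X) =
      tmap scale 2 1 (mul_map scale mul) id (sigma_at scale \<sigma> 3 2 (sigma_at scale \<sigma> 3 1 X))"
    and unit_right: "\<forall>a. \<sigma> (tens scale [a, one]) = tens scale [one, a]"
    and unit_left: "\<forall>a. \<sigma> (tens scale [one, a]) = tens scale [a, one]"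
  shows "\<forall>n. \<forall>X\<in>ppow scale n.
    quantum_shuffle scale \<sigma> X = mul_pow scale mul n (Theta scale \<sigma> one n X)"
proof (intro allI ballI)
  fix n X assume X: "X \<in> ppow scale n"
  interpret unital_algebra scale mul one by (rule algebra)
  let ?W = "word_rel scale" and ?P = "pair_rel scale"
  have \<sigma>: "tlinear scale 2 2 \<sigma>"
    using aut unfolding tensor_aut_def tpow_eq_qcar
    by (intro qlinear_if_additive subspace_word_rel) (auto dest: bij_betwE)
  have unit: "\<sigma> (tens scale [a, one]) = tens scale [one, a]"
    "\<sigma> (tens scale [one, a]) = tens scale [a, one]" for a
    using unit_right unit_left by auto
  note main = mul_pow_sigma_word_shuffle[OF \<sigma> unit]

  \<comment> \<open>One formula for all degrees: the sum over shuffles, also when a word is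
    empty.\<close>
  define G where "G p n X = qsum ?W (\<lambda>w. qscale ?W (of_int (sign w)) (T_perm scale \<sigma> n w X))
    (shuffle_perms p n)" for p n X
  have G: "tlinear scale n n (G p n)" if "p \<le> n" for p n
    unfolding G_def using main(2) that by (intro qlinear_qsum_fun subspace_word_rel) auto
  have G_trivial: "G p n (tens scale as) = tens scale as" if "p = 0 \<or> p = n" for p n as
  proof -
    have "G p n (tens scale as) = coset ?W (\<Sum>w\<in>{id :: nat \<Rightarrow> nat}. Poly_Mapping.single as 1)"
      unfolding G_def shuffle_perms_trivial[OF that] tens_def
      by (intro qsum_coset' subspace_word_rel) (simp only: singleton_iff T_perm_id, simp add: sign_id)
    then show ?thesis by (simp add: tens_def)
  qed

  let ?F = "\<lambda>(as, bs). G (length as) (length as + length bs) (tens scale (as @ bs))"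
  have qs: "quantum_shuffle scale \<sigma> = lift ?W UNIV ?F"
    unfolding quantum_shuffle_def
  proof (intro arg_cong[of _ _ "lift ?W UNIV"] ext, clarify)
    fix as bs :: "'a list"
    show "(if as = [] then tens scale bs else if bs = [] then tens scale as
      else let p = length as; n = length as + length bs in
       qsum ?W (\<lambda>w. qscale ?W (of_int (sign w)) (T_perm scale \<sigma> n w (conc scale (ptens scale as bs))))
         (shuffle_perms p n)) = G (length as) (length as + length bs) (tens scale (as @ bs))"
    proof (cases "as = [] \<or> bs = []")
      case True
      then show ?thesis by (auto simp: G_trivial)
    next
      case False
      then show ?thesis by (simp add: G_def Let_def)
    qed
  qed
  have lin_F: "linear_into scale ?W (\<lambda>a. ?F (us @ a # vs, ws))"
    "linear_into scale ?W (\<lambda>a. ?F (ws, us @ a # vs))" for us vs ws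
  proof -
    let ?n = "length us + Suc (length vs) + length ws"
    have "linear_into scale ?W (\<lambda>a. G (length us + Suc (length vs)) ?n (tens scale (us @ a # vs @ ws)))"
      by (rule linear_into_compose[OF subspace_word_rel subspace_word_rel linear_into_tens G])
        (auto intro: tens_mem_qcar)
    then show "linear_into scale ?W (\<lambda>a. ?F (us @ a # vs, ws))" by simp
    have "linear_into scale ?W (\<lambda>a. G (length ws) (length ws + (length us + Suc (length vs)))
        (tens scale ((ws @ us) @ a # vs)))"
      by (rule linear_into_compose[OF subspace_word_rel subspace_word_rel linear_into_tens G])
        (auto intro: tens_mem_qcar)
    then show "linear_into scale ?W (\<lambda>a. ?F (ws, us @ a # vs))" by simp
  qed
  have car_F: "?F (as, bs) \<in> qcar ?W UNIV" for as bs
    unfolding prod.case by (rule tpow_qcar_UNIV[OF tlinear_mem[OF G tens_mem]]) simp_all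
  have Q: "qlinear ?P UNIV ?W UNIV (quantum_shuffle scale \<sigma>)"
    unfolding qs by (rule qlinear_lift_pairs[OF subspace_word_rel _ _ car_F lin_F]) simp_all
  have Q_ptens: "quantum_shuffle scale \<sigma> (ptens scale as bs) = ?F (as, bs)" for as bs
    unfolding qs by (rule lift_pairs_ptens[OF subspace_word_rel _ _ car_F lin_F]) simp_all

  let ?l = "\<lambda>p w as. fill one (left_pattern p n w) as" and ?r = "\<lambda>p w bs. fill one (right_pattern p n w) bs"
  let ?H = "\<lambda>(as, bs). qsum ?P (\<lambda>w. qscale ?P (of_int (sign w))
    (ptens scale (?l (length as) w as) (?r (length as) w bs))) (shuffle_perms (length as) n)"
  let ?H' = "\<lambda>(as, bs). let p = length as in
       qsum ?P
         (\<lambda>w. qscale ?P (of_int (sign w))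
           (otimes scale
             (insert_units scale one p (map (\<lambda>j. w j - 1) [p + 1..<n + 1]) (tens scale as))
             (insert_units scale one (n - p) (map (\<lambda>j. w j - 1) [1..<p + 1]) (tens scale bs))))
         (shuffle_perms p n)"
  \<comment> \<open>For total length \<open>n\<close> the second word has
    \<open>n - length as\<close> letters, and the composites of the \<open>s'\<close> become
    fillings of patterns.\<close>
  have H: "?H' (as, bs) = ?H (as, bs)" if "(as, bs) \<in> word_pairs n" for as bs
  proof -
    have len: "length as \<le> n" "length bs = n - length as" using that by auto
    show ?thesis
      unfolding Let_def prod.case
      by (rule qsum_cong) (simp only: insert_units_left_pattern[OF _ len(1) refl] insert_units_right_pattern[OF _ len] otimes_tens)
  qed
  have lin_H: "linear_into scale ?P (\<lambda>a. ?H (us @ a # vs, ws))"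
    if "(us @ a # vs, ws) \<in> word_pairs n" for us vs ws a
  proof -
    let ?p = "length us + Suc (length vs)"
    have "linear_into scale ?P (\<lambda>a. ptens scale (?l ?p w (us @ a # vs)) (?r ?p w ws))"
      if "w \<in> shuffle_perms ?p n" for w
    proof -
      have len: "length us + Suc (length vs) = length (labels (left_pattern ?p n w))"
        using labels_left_pattern[OF that] \<open>(us @ a # vs, ws) \<in> word_pairs n\<close> by simp
      obtain us' vs' where "\<forall>a. ?l ?p w (us @ a # vs) = us' @ a # vs'"
        using fill_slot[OF len] by blast
      then show ?thesis using linear_into_ptens_left[of scale us' vs'] by simp
    qed
    then have "linear_into scale ?P (\<lambda>a. qsum ?P (\<lambda>w. qscale ?P (of_int (sign w))
        (ptens scale (?l ?p w (us @ a # vs)) (?r ?p w ws))) (shuffle_perms ?p n))"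
      by (intro linear_into_qsum subspace_pair_rel ptens_mem_qcar) auto
    then show ?thesis by simp
  qed
  have lin_H': "linear_into scale ?P (\<lambda>a. ?H (ws, us @ a # vs))"
    if "(ws, us @ a # vs) \<in> word_pairs n" for us vs ws a
  proof -
    let ?p = "length ws"
    have "linear_into scale ?P (\<lambda>a. ptens scale (?l ?p w ws) (?r ?p w (us @ a # vs)))"
      if "w \<in> shuffle_perms ?p n" for w
    proof -
      have len: "length us + Suc (length vs) = length (labels (right_pattern ?p n w))"
        using labels_right_pattern[OF that] \<open>(ws, us @ a # vs) \<in> word_pairs n\<close> by auto
      obtain us' vs' where "\<forall>a. ?r ?p w (us @ a # vs) = us' @ a # vs'"
        using fill_slot[OF len] by blast
      then show ?thesis using linear_into_ptens_right[of scale _ us' vs'] by simp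
    qed
    then have "linear_into scale ?P (\<lambda>a. qsum ?P (\<lambda>w. qscale ?P (of_int (sign w))
        (ptens scale (?l ?p w ws) (?r ?p w (us @ a # vs)))) (shuffle_perms ?p n))"
      by (intro linear_into_qsum subspace_pair_rel ptens_mem_qcar) auto
    then show ?thesis by simp
  qed
  have pairs: "(?l p w as, ?r p w bs) \<in> word_pairs (2 * n)" for p w as bs
    by (simp add: left_pattern_def right_pattern_def)
  have car_H: "?H (as, bs) \<in> qcar ?P (word_pairs (2 * n))" for as bs
    unfolding prod.case using pairs by (intro qsum_mem_qcar subspace_pair_rel ptens_mem_qcar)
  \<comment> \<open>Replacing an entry keeps the total length, so \<open>H\<close> applies for every
    value in the slot and linearity carries over from \<open>?H\<close>.\<close>
  have lin_H'1: "linear_into scale ?P (\<lambda>a. ?H' (us @ a # vs, ws))"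
    if d: "(us @ a # vs, ws) \<in> word_pairs n" for us vs ws a
  proof -
    have "?H' (us @ b # vs, ws) = ?H (us @ b # vs, ws)" for b by (rule H) (use d in simp)
    then show ?thesis using lin_H[OF d] by (simp only:)
  qed
  have lin_H'2: "linear_into scale ?P (\<lambda>a. ?H' (ws, us @ a # vs))"
    if d: "(ws, us @ a # vs) \<in> word_pairs n" for us vs ws a
  proof -
    have "?H' (ws, us @ b # vs) = ?H (ws, us @ b # vs)" for b by (rule H) (use d in simp)
    then show ?thesis using lin_H'[OF d] by (simp only:)
  qed
  have car_H': "?H' (as, bs) \<in> qcar ?P (word_pairs (2 * n))" if "(as, bs) \<in> word_pairs n" for as bs
    unfolding H[OF that] by (rule car_H)
  have g: "qlinear ?P UNIV ?P (word_pairs (2 * n)) (g_map scale one n)"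
    unfolding g_map_def
    by (rule qlinear_lift_pairs[OF subspace_pair_rel _ _ car_H' lin_H'1 lin_H'2]) simp_all
  have g_ptens: "g_map scale one n (ptens scale as bs) = ?H (as, bs)" if "(as, bs) \<in> word_pairs n" for as bs
    unfolding g_map_def H[OF that, symmetric]
    by (rule lift_pairs_ptens[OF subspace_pair_rel _ _ car_H' lin_H'1 lin_H'2 that]) simp_all

  let ?\<Psi> = "concat (map (\<lambda>k. [2 * k..<n + k]) (rev [1..<n]))"
  \<comment> \<open>For \<open>n < 2\<close> the word is empty, in accordance with the convention
    that \<open>\<psi>\<close> is the identity there; otherwise it is the word of \<open>psi\<close>
    for \<open>m = n - 2\<close>.\<close>
  have Theta: "Theta scale \<sigma> one n Y = sigma_word scale \<sigma> (2 * n) ?\<Psi> (conc scale (g_map scale one n Y))" for Y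
  proof (cases "n < 2")
    case True
    then have "?\<Psi> = []" by (cases n) auto
    then show ?thesis using True by (simp add: Theta_def sigma_word_def)
  next
    case False
    then have "2 * (n - 2) + 4 = 2 * n" "n - 2 + 2 = n" "n - 2 + k + 2 = n + k" for k by simp_all
    then show ?thesis using False by (simp only: Theta_def psi_def o_apply if_False)
  qed
  define K where "K Y = mul_pow scale mul n (sigma_word scale \<sigma> (2 * n) ?\<Psi> (conc scale Y))" for Y
  \<comment> \<open>The word does not depend on the shuffle, so the bound is read off from the
    identity with \<open>p = 0\<close>.\<close>
  have \<Psi>: "set ?\<Psi> \<subseteq> {1..<2 * n}"
    using main(1)[of id 0 n] shuffle_perms_trivial[of 0 n] by simp
  have K: "qlinear ?P (word_pairs (2 * n)) ?W (words n) K"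
    unfolding K_def
  proof (intro qlinear_compose[OF qlinear_compose[OF _ tlinear_sigma_word[OF \<sigma> \<Psi>]] tlinear_mul_pow])
    show "qlinear ?P (word_pairs (2 * n)) ?W (words (2 * n)) (conc scale)"
      by (rule qlinear_restrict[OF subspace_pair_rel subspace_word_rel
          qlinear_weaken[OF qlinear_conc subset_UNIV subset_UNIV]])
        (auto simp: ptens_def[symmetric] intro!: tens_mem_qcar)
  qed
  have KQ: "qlinear ?P (word_pairs n) ?W (words n) (\<lambda>Y. K (g_map scale one n Y))"
    by (rule qlinear_weaken[OF qlinear_compose[OF g K]]) simp_all
  have "quantum_shuffle scale \<sigma> X = K (g_map scale one n X)"
  proof (rule qlinear_eqI[OF qlinear_weaken[OF Q subset_UNIV order_refl] KQ _ subspace_word_rel])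
    show "X \<in> qcar ?P (word_pairs n)" using X by (simp add: ppow_eq_qcar)
    fix k :: "'a list \<times> 'a list" assume "k \<in> word_pairs n"
    then obtain as bs where k: "k = (as, bs)" "length as + length bs = n" by auto
    let ?p = "length as"
    have p: "?p \<le> n" "length bs = n - ?p" using k by auto
    \<comment> \<open>Linearity of \<open>K\<close> distributes it over the shuffles, after which
      the two sums are compared term by term.\<close>
    have "K (g_map scale one n (ptens scale as bs))
        = qsum ?W (\<lambda>w. qscale ?W (of_int (sign w)) (K (ptens scale (?l ?p w as) (?r ?p w bs)))) (shuffle_perms ?p n)"
      using g_ptens[of as bs] k pairs
      by (simp add: qlinear_qsum[OF subspace_pair_rel subspace_word_rel K] ptens_mem_qcar)
    also have "\<dots> = G ?p n (tens scale (as @ bs))"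
      unfolding G_def K_def conc_ptens
      by (rule qsum_cong) (simp only: main(3)[OF _ p(1) refl p(2)])
    also have "\<dots> = quantum_shuffle scale \<sigma> (ptens scale as bs)"
      using Q_ptens k by simp
    finally show "quantum_shuffle scale \<sigma> (coset ?P (Poly_Mapping.single k 1))
        = K (g_map scale one n (coset ?P (Poly_Mapping.single k 1)))"
      unfolding k ptens_def by simp
  qed
  then show "quantum_shuffle scale \<sigma> X = mul_pow scale mul n (Theta scale \<sigma> one n X)"
    unfolding Theta K_def .
qed

end
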